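(* Let $n\in\mathbb{N}$, let $E=E(\mathbb{R}^n)$ be a rearrangement-invariant space, and let $\Phi\in B_n(\infty)$. Then the cones $K_1$, $K_2$, $K_3$ (defined in the context) are equivalent: $$K_1\approx K_2\approx K_3 .$$
   Context: A rearrangement-invariant space (RIS) $E=E(\mathbb{R}^n)$ is a Banach function space (in the sense of Bennett–Sharpley) on $\mathbb{R}^n$ with Lebesgue measure whose norm satisfies $\|f\|_E\le\|g\|_E$ whenever $f^*\le g^*$. For measurable $f$, $f^*(t)=\inf\{y>0:\ |\{x:|f(x)|>y\}|\le t\}$ is the nonincreasing rearrangement and $f^{**}(t)=\frac1t\int_0^t f^*(\tau)\,d\tau$, $t>0$. Class $B_n(\infty)$: a function $\Phi:(0,\infty)\to(0,\infty)$ belongs to $B_n(\infty)$ if $\Phi$ is decreasing and continuous on $(0,\infty)$ and there is $C>0$ with $\int_0^r\Phi(\rho)\rho^{n-1}\,d\rho\le C\,\Phi(r)r^n$ for all $r\in(0,\infty)$. Generalized fractional maximal function: for $f\in E\cap L^1_{loc}(\mathbb{R}^n)$, $(M_\Phi f)(x)=\sup_{r>0}\Phi(r)\int_{B(x,r)}|f(y)|\,dy$, where $B(x,r)$ is the ball of center $x$, radius $r$. The space $M_E^\Phi=M_E^\Phi(\mathbb{R}^n)$ consists of all $u$ such that $u=M_\Phi f$ for some $f\in E$, with $\|u\|_{M_E^\Phi}=\inf\{\|f\|_E:\ f\in E,\ M_\Phi f=u\}$. Cones (sets of nonnegative measurable functions on $(0,\infty)$ with positive homogeneous functionals): $K_1=\{h:\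 h=u^*\text{ on }(0,\infty)\text{ for some }u\in M_E^\Phi\}$, $\rho_{K_1}(h)=\inf\{\|u\|_{M_E^\Phi}: u\in M_E^\Phi,\ u^*=h\}$; $K_2=\{h:\ h=u^{**}\text{ for some }u\in M_E^\Phi\}$, $\rho_{K_2}(h)=\inf\{\|u\|_{M_E^\Phi}: u\in M_E^\Phi,\ u^{**}=h\}$; $K_3=\{h:\ h(t)=\sup_{t<\tau<\infty}\tau\Phi(\tau^{1/n})u^{**}(\tau)\ \forall t>0,\text{ for some }u\in E\}$, $\rho_{K_3}(h)=\inf\{\|u\|_E: u\in E,\ \sup_{t<\tau<\infty}\tau\Phi(\tau^{1/n})u^{**}(\tau)=h(t)\ \forall t>0\}$. Covering: for two such cones $M,K$, we write $M\prec K$ ($K$ covers $M$) if there is $C_0>0$ such that for every $h_1\in M$ there exists $h_2\in K$ with $\rho_K(h_2)\le C_0\rho_M(h_1)$ and $h_1(t)\le h_2(t)$ for all $t\in(0,\infty)$. Equivalence $M\approx K$ means $M\prec K$ and $K\prec M$. *)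

theory Defs
  imports "HOL-Analysis.Analysis"
begin

text \<open>Functions on R^n are modelled on the type real^'n (n = CARD('n)), with Lebesgue
measure lebesgue. Following Bennett--Sharpley, a function norm acts on nonnegative
(extended-valued) Lebesgue measurable functions.\<close>

text \<open>Nonincreasing rearrangement f^*(t) = inf{y>0 : |{x : g x > y}| <= t} (for t > 0),
of a nonnegative (possibly infinite) function g; for a real f one uses g = |f|.\<close>
definition rearr :: "('a::euclidean_space \<Rightarrow> ennreal) \<Rightarrow> real \<Rightarrow> ennreal" where
  "rearr g t = Inf {y::ennreal. 0 < y \<and> emeasure lebesgue {x. y < g x} \<le> ennreal t}"

text \<open>f^{**}(t) = (1/t) * integral_0^t f^*(s) ds  (for t > 0).\<close>
definition rearr2 :: "('a::euclidean_space \<Rightarrow> ennreal) \<Rightarrow> real \<Rightarrow> ennreal" where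
  "rearr2 g t = set_nn_integral lborel {0<..<t} (rearr g) / ennreal t"

text \<open>Banach function norm (Bennett--Sharpley, axioms P1--P5).\<close>
definition banach_function_norm :: "(('a::euclidean_space \<Rightarrow> ennreal) \<Rightarrow> ennreal) \<Rightarrow> bool" where
  "banach_function_norm \<rho> \<longleftrightarrow>
     (\<forall>f \<in> borel_measurable lebesgue. \<rho> f = 0 \<longleftrightarrow> (AE x in lebesgue. f x = 0)) \<and>
     (\<forall>f \<in> borel_measurable lebesgue. \<forall>a::real. 0 \<le> a \<longrightarrow>
         \<rho> (\<lambda>x. ennreal a * f x) = ennreal a * \<rho> f) \<and>
     (\<forall>f \<in> borel_measurable lebesgue. \<forall>g \<in> borel_measurable lebesgue.
         \<rho> (\<lambda>x. f x + g x) \<le> \<rho> f + \<rho> g) \<and>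
     (\<forall>f \<in> borel_measurable lebesgue. \<forall>g \<in> borel_measurable lebesgue.
         (AE x in lebesgue. g x \<le> f x) \<longrightarrow> \<rho> g \<le> \<rho> f) \<and>
     (\<forall>fs f. (\<forall>k. fs k \<in> borel_measurable lebesgue) \<and> f \<in> borel_measurable lebesgue \<and>
         (AE x in lebesgue. incseq (\<lambda>k. fs k x) \<and> (SUP k. fs k x) = f x)
         \<longrightarrow> \<rho> f = (SUP k. \<rho> (fs k))) \<and>
     (\<forall>A \<in> sets lebesgue. emeasure lebesgue A < \<infinity> \<longrightarrow> \<rho> (indicator A) < \<infinity>) \<and>
     (\<forall>A \<in> sets lebesgue. emeasure lebesgue A < \<infinity> \<longrightarrow>
         (\<exists>C::real. \<forall>f \<in> borel_measurable lebesgue.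
            set_nn_integral lebesgue A f \<le> ennreal C * \<rho> f))"

text \<open>Rearrangement-invariant Banach function norm: rho f <= rho g whenever f^* <= g^*.\<close>
definition ri_norm :: "(('a::euclidean_space \<Rightarrow> ennreal) \<Rightarrow> ennreal) \<Rightarrow> bool" where
  "ri_norm \<rho> \<longleftrightarrow> banach_function_norm \<rho> \<and>
     (\<forall>f \<in> borel_measurable lebesgue. \<forall>g \<in> borel_measurable lebesgue.
        (\<forall>t>0. rearr f t \<le> rearr g t) \<longrightarrow> \<rho> f \<le> \<rho> g)"

text \<open>The space E and its norm ||f||_E = rho(|f|).\<close>
definition Espace :: "(('a::euclidean_space \<Rightarrow> ennreal) \<Rightarrow> ennreal) \<Rightarrow> ('a \<Rightarrow> real) set" where
  "Espace \<rho> = {f. f \<in> borel_measurable lebesgue \<and> \<rho> (\<lambda>x. ennreal \<bar>f x\<bar>) < \<infinity>}"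

definition Enorm :: "(('a::euclidean_space \<Rightarrow> ennreal) \<Rightarrow> ennreal) \<Rightarrow> ('a \<Rightarrow> real) \<Rightarrow> ennreal" where
  "Enorm \<rho> f = \<rho> (\<lambda>x. ennreal \<bar>f x\<bar>)"

definition locally_integrable :: "('a::euclidean_space \<Rightarrow> real) \<Rightarrow> bool" where
  "locally_integrable f \<longleftrightarrow> (\<forall>K. compact K \<longrightarrow> set_integrable lebesgue K f)"

text \<open>The class B_n(infinity).\<close>
definition class_B :: "nat \<Rightarrow> (real \<Rightarrow> real) \<Rightarrow> bool" where
  "class_B n \<Phi> \<longleftrightarrow>
     (\<forall>r>0. 0 < \<Phi> r) \<and>
     (\<forall>r s. 0 < r \<longrightarrow> r \<le> s \<longrightarrow> \<Phi> s \<le> \<Phi> r) \<and>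
     continuous_on {0<..} \<Phi> \<and>
     (\<exists>C>0. \<forall>r>0. set_nn_integral lborel {0<..<r} (\<lambda>s. ennreal (\<Phi> s * s ^ (n - 1)))
                    \<le> ennreal (C * \<Phi> r * r ^ n))"

text \<open>Generalized fractional maximal function.\<close>
definition maxfn :: "(real \<Rightarrow> real) \<Rightarrow> ('a::euclidean_space \<Rightarrow> real) \<Rightarrow> 'a \<Rightarrow> ennreal" where
  "maxfn \<Phi> f x = (SUP r\<in>{0<..}. ennreal (\<Phi> r) *
       set_nn_integral lebesgue (ball x r) (\<lambda>y. ennreal \<bar>f y\<bar>))"

definition MEspace :: "(('a::euclidean_space \<Rightarrow> ennreal) \<Rightarrow> ennreal) \<Rightarrow> (real \<Rightarrow> real) \<Rightarrow> ('a \<Rightarrow> ennreal) set" where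
  "MEspace \<rho> \<Phi> = {u. \<exists>f \<in> Espace \<rho>. locally_integrable f \<and> maxfn \<Phi> f = u}"

definition MEnorm :: "(('a::euclidean_space \<Rightarrow> ennreal) \<Rightarrow> ennreal) \<Rightarrow> (real \<Rightarrow> real) \<Rightarrow> ('a \<Rightarrow> ennreal) \<Rightarrow> ennreal" where
  "MEnorm \<rho> \<Phi> u = (INF f\<in>{f \<in> Espace \<rho>. locally_integrable f \<and> maxfn \<Phi> f = u}. Enorm \<rho> f)"

text \<open>Cones of functions on (0,infinity) (values outside (0,infinity) are irrelevant).\<close>
definition K1 :: "(('a::euclidean_space \<Rightarrow> ennreal) \<Rightarrow> ennreal) \<Rightarrow> (real \<Rightarrow> real) \<Rightarrow> (real \<Rightarrow> ennreal) set" where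
  "K1 \<rho> \<Phi> = {h. \<exists>u \<in> MEspace \<rho> \<Phi>. \<forall>t>0. h t = rearr u t}"

definition rhoK1 :: "(('a::euclidean_space \<Rightarrow> ennreal) \<Rightarrow> ennreal) \<Rightarrow> (real \<Rightarrow> real) \<Rightarrow> (real \<Rightarrow> ennreal) \<Rightarrow> ennreal" where
  "rhoK1 \<rho> \<Phi> h = (INF u\<in>{u \<in> MEspace \<rho> \<Phi>. \<forall>t>0. rearr u t = h t}. MEnorm \<rho> \<Phi> u)"

definition K2 :: "(('a::euclidean_space \<Rightarrow> ennreal) \<Rightarrow> ennreal) \<Rightarrow> (real \<Rightarrow> real) \<Rightarrow> (real \<Rightarrow> ennreal) set" where
  "K2 \<rho> \<Phi> = {h. \<exists>u \<in> MEspace \<rho> \<Phi>. \<forall>t>0. h t = rearr2 u t}"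

definition rhoK2 :: "(('a::euclidean_space \<Rightarrow> ennreal) \<Rightarrow> ennreal) \<Rightarrow> (real \<Rightarrow> real) \<Rightarrow> (real \<Rightarrow> ennreal) \<Rightarrow> ennreal" where
  "rhoK2 \<rho> \<Phi> h = (INF u\<in>{u \<in> MEspace \<rho> \<Phi>. \<forall>t>0. rearr2 u t = h t}. MEnorm \<rho> \<Phi> u)"

definition K3fun :: "nat \<Rightarrow> (real \<Rightarrow> real) \<Rightarrow> ('a::euclidean_space \<Rightarrow> real) \<Rightarrow> real \<Rightarrow> ennreal" where
  "K3fun n \<Phi> u t = (SUP \<tau>\<in>{t<..}. ennreal (\<tau> * \<Phi> (root n \<tau>)) * rearr2 (\<lambda>x. ennreal \<bar>u x\<bar>) \<tau>)"

definition K3 :: "nat \<Rightarrow> (('a::euclidean_space \<Rightarrow> ennreal) \<Rightarrow> ennreal) \<Rightarrow> (real \<Rightarrow> real) \<Rightarrow> (real \<Rightarrow> ennreal) set" where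
  "K3 n \<rho> \<Phi> = {h. \<exists>u \<in> Espace \<rho>. \<forall>t>0. h t = K3fun n \<Phi> u t}"

definition rhoK3 :: "nat \<Rightarrow> (('a::euclidean_space \<Rightarrow> ennreal) \<Rightarrow> ennreal) \<Rightarrow> (real \<Rightarrow> real) \<Rightarrow> (real \<Rightarrow> ennreal) \<Rightarrow> ennreal" where
  "rhoK3 n \<rho> \<Phi> h = (INF u\<in>{u \<in> Espace \<rho>. \<forall>t>0. K3fun n \<Phi> u t = h t}. Enorm \<rho> u)"

text \<open>Covering M \<prec> K, and equivalence of cones.\<close>
definition covered_by :: "(real \<Rightarrow> ennreal) set \<Rightarrow> ((real \<Rightarrow> ennreal) \<Rightarrow> ennreal)
    \<Rightarrow> (real \<Rightarrow> ennreal) set \<Rightarrow> ((real \<Rightarrow> ennreal) \<Rightarrow> ennreal) \<Rightarrow> bool" where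
  "covered_by M \<rho>M K \<rho>K \<longleftrightarrow> (\<exists>C0::real. C0 > 0 \<and>
     (\<forall>h1 \<in> M. \<exists>h2 \<in> K. \<rho>K h2 \<le> ennreal C0 * \<rho>M h1 \<and> (\<forall>t>0. h1 t \<le> h2 t)))"

definition cone_equiv :: "(real \<Rightarrow> ennreal) set \<Rightarrow> ((real \<Rightarrow> ennreal) \<Rightarrow> ennreal)
    \<Rightarrow> (real \<Rightarrow> ennreal) set \<Rightarrow> ((real \<Rightarrow> ennreal) \<Rightarrow> ennreal) \<Rightarrow> bool" where
  "cone_equiv M \<rho>M K \<rho>K \<longleftrightarrow> covered_by M \<rho>M K \<rho>K \<and> covered_by K \<rho>K M \<rho>M"

end

theory Submission
  imports Defs
begin

text \<open>
  Every element of \<open>E\<close> is locally integrable, so the three cones are the images of \<open>E\<close> under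
  \<open>T\<^sub>1 f = (M\<^sub>\<Phi> f)\<^sup>*\<close>, \<open>T\<^sub>2 f = (M\<^sub>\<Phi> f)\<^sup>*\<^sup>*\<close> and \<open>T\<^sub>3 f(t) = sup\<^bsub>\<tau> > t\<^esub> \<Phi>(\<tau>\<^sup>1\<^sup>/\<^sup>n) \<integral>\<^sub>0\<^sup>\<tau> f\<^sup>*\<close>.
  Trivially \<open>T\<^sub>1 f \<le> T\<^sub>2 f\<close>. For \<open>T\<^sub>2 f \<le> C T\<^sub>3 f\<close> put \<open>R = t\<^sup>1\<^sup>/\<^sup>n\<close>: balls of radius at least \<open>R\<close> contribute
  at most \<open>C T\<^sub>3 f(t)\<close> to \<open>M\<^sub>\<Phi> f\<close>, and those of radius at most \<open>R\<close> at most the convolution of \<open>\<bar>f\<bar>\<close>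
  with \<open>k\<^sub>R(z) = \<Phi>(\<bar>z\<bar>) 1\<^bsub>\<bar>z\<bar> < R\<^esub>\<close>; then \<open>(k\<^sub>R * \<bar>f\<bar>)\<^sup>*\<^sup>* \<le> \<parallel>k\<^sub>R\<parallel>\<^sub>1 f\<^sup>*\<^sup>*\<close> by O'Neil's inequality, and
  \<open>\<parallel>k\<^sub>R\<parallel>\<^sub>1 \<le> C \<Phi>(R) R\<^sup>n\<close> is the class condition in polar coordinates. Finally, let \<open>h\<close> be the radial
  decreasing rearrangement of \<open>f\<close>. The ball of radius \<open>2r\<close> around any point of \<open>B(0, r)\<close> contains
  \<open>B(0, r)\<close>, whence \<open>T\<^sub>3 f \<le> C T\<^sub>1 h\<close> by the doubling property of \<open>\<Phi>\<close>.

  If every \<open>T f\<close> is dominated by a multiple of some \<open>S g\<close> with \<open>\<parallel>g\<parallel> \<le> \<parallel>f\<parallel>\<close>, then near-minimisers show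
  that the cone of \<open>S\<close> covers the cone of \<open>T\<close>, except at those \<open>h \<noteq> 0\<close> whose gauge is \<open>0\<close>. If there
  are any, then some \<open>T f\<close> takes the value \<open>\<infinity>\<close>. But \<open>T\<^sub>3 f\<close> is infinite everywhere or nowhere, so when
  one of \<open>T\<close> and \<open>S\<close> is \<open>T\<^sub>3\<close>, the constant \<open>\<infinity>\<close> belongs to the cone of \<open>S\<close>, where its gauge is \<open>0\<close>.
\<close>

section \<open>The layer cake formula\<close>

lemma sigma_finite_measure_completion:
  assumes "sigma_finite_measure M"
  shows "sigma_finite_measure (completion M)"
proof
  obtain \<A> where "countable \<A>" "\<A> \<subseteq> sets M" "\<Union>\<A> = space M" "\<forall>A\<in>\<A>. emeasure M A \<noteq> \<infinity>"
    using sigma_finite_measure.sigma_finite_countable[OF assms] by blast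
  then show "\<exists>\<A>. countable \<A> \<and> \<A> \<subseteq> sets (completion M) \<and> \<Union>\<A> = space (completion M)
      \<and> (\<forall>A\<in>\<A>. emeasure (completion M) A \<noteq> \<infinity>)"
    by (intro exI[of _ \<A>]) auto
qed

lemma borel_measurable_lebesgueI: "f \<in> borel_measurable borel \<Longrightarrow> f \<in> borel_measurable lebesgue"
  by (simp add: measurable_completion)

lemma emeasure_lborel_ennreal_less:
  "emeasure lborel {y::real. 0 < y \<and> ennreal y < c} = c"
proof (cases c)
  case (real r)
  then have "{y::real. 0 < y \<and> ennreal y < c} = {0<..<r}"
    by (auto simp: ennreal_less_iff)
  with real show ?thesis by simp
next
  case top
  have "z \<le> emeasure lborel {y::real. 0 < y \<and> ennreal y < c}" if "z < top" for z
  proof -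
    obtain r where r: "z = ennreal r" "0 \<le> r"
      using \<open>z < top\<close> by (cases z) auto
    then have "z = emeasure lborel {0<..<r}" by simp
    also have "\<dots> \<le> emeasure lborel {y::real. 0 < y \<and> ennreal y < c}"
      using top by (intro emeasure_mono) auto
    finally show ?thesis .
  qed
  then have "top \<le> emeasure lborel {y::real. 0 < y \<and> ennreal y < c}"
    by (rule dense_le)
  with top show ?thesis by (simp add: top_unique)
qed

lemma set_nn_integral_layer_cake:
  assumes "sigma_finite_measure M"
    and [measurable]: "g \<in> borel_measurable M" "A \<in> sets M"
  shows "set_nn_integral M A g
    = (\<integral>\<^sup>+y. emeasure M {x \<in> A. ennreal y < g x} * indicator {0<..} y \<partial>lborel)"
proof -
  interpret sigma_finite_measure M by fact
  interpret pair_sigma_finite M "lborel :: real measure" ..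
  let ?region = "{p \<in> space (M \<Otimes>\<^sub>M (lborel :: real measure)).
    fst p \<in> A \<and> 0 < snd p \<and> ennreal (snd p) < g (fst p)}"
  have "A \<subseteq> space M" using assms(3) by (rule sets.sets_into_space)
  have "set_nn_integral M A g
      = (\<integral>\<^sup>+x. (\<integral>\<^sup>+y. indicator {y. 0 < y \<and> ennreal y < g x} y * indicator A x \<partial>lborel) \<partial>M)"
    by (simp add: nn_integral_multc emeasure_lborel_ennreal_less)
  also have "\<dots> = (\<integral>\<^sup>+x. (\<integral>\<^sup>+y. indicator ?region (x, y) \<partial>lborel) \<partial>M)"
    by (intro nn_integral_cong) (auto simp: indicator_def space_pair_measure)
  also have "\<dots> = (\<integral>\<^sup>+y. (\<integral>\<^sup>+x. indicator ?region (x, y) \<partial>M) \<partial>lborel)"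
    by (rule Fubini'[symmetric]) (simp add: case_prod_unfold)
  also have "\<dots> = (\<integral>\<^sup>+y. (\<integral>\<^sup>+x. indicator {x \<in> A. ennreal y < g x} x * indicator {0<..} y \<partial>M) \<partial>lborel)"
    using \<open>A \<subseteq> space M\<close> by (intro nn_integral_cong) (auto simp: indicator_def space_pair_measure)
  also have "\<dots> = (\<integral>\<^sup>+y. emeasure M {x \<in> A. ennreal y < g x} * indicator {0<..} y \<partial>lborel)"
  proof -
    have "{x \<in> A. ennreal y < g x} = {x \<in> space M. x \<in> A \<and> ennreal y < g x}" for y
      using \<open>A \<subseteq> space M\<close> by auto
    then have "{x \<in> A. ennreal y < g x} \<in> sets M" for y
      by simp
    then show ?thesis by (simp add: nn_integral_multc)
  qed
  finally show ?thesis .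
qed

section \<open>Distribution function and nonincreasing rearrangement\<close>

definition distribution_function :: "('a::euclidean_space \<Rightarrow> ennreal) \<Rightarrow> ennreal \<Rightarrow> ennreal" where
  "distribution_function g y = emeasure lebesgue {x. y < g x}"

lemma sets_lebesgue_superlevel:
  fixes g :: "'a::euclidean_space \<Rightarrow> ennreal"
  assumes "g \<in> borel_measurable lebesgue"
  shows "{x. y < g x} \<in> sets lebesgue"
  using borel_measurable_less[OF borel_measurable_const assms, of y] by simp

lemma distribution_function_mono_AE:
  assumes "g \<in> borel_measurable lebesgue" and "AE x in lebesgue. y < f x \<longrightarrow> z < g x"
  shows "distribution_function f y \<le> distribution_function g z"
  unfolding distribution_function_def using assms(2)
  by (intro emeasure_mono_AE sets_lebesgue_superlevel assms(1)) auto

lemma distribution_function_le_right_limit: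
  assumes g_measurable: "g \<in> borel_measurable lebesgue"
    and above: "\<And>z. y < z \<Longrightarrow> distribution_function g z \<le> c"
  shows "distribution_function g y \<le> c"
proof (cases "y = top")
  case True
  then show ?thesis by (simp add: distribution_function_def)
next
  case False
  define u where "u n = y + ennreal (1 / real (Suc n))" for n
  have y_less_u: "y < u n" for n
    using False by (cases y) (auto simp: u_def ennreal_less_iff simp flip: ennreal_plus)
  have decseq_u: "u m \<le> u n" if "n \<le> m" for m n
    using that by (auto simp: u_def intro!: add_left_mono ennreal_leI frac_le)
  have "u \<longlonglongrightarrow> y + ennreal 0"
    unfolding u_def by (intro tendsto_intros tendsto_ennrealI LIMSEQ_Suc[OF lim_1_over_n])
  then have lim_u: "u \<longlonglongrightarrow> y" by simp
  have "{x. y < g x} = (\<Union>n. {x. u n < g x})"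
  proof (intro set_eqI iffI)
    fix x assume "x \<in> {x. y < g x}"
    then have "eventually (\<lambda>n. u n < g x) sequentially"
      using order_tendstoD(2)[OF lim_u] by simp
    then show "x \<in> (\<Union>n. {x. u n < g x})"
      by (auto simp: eventually_sequentially)
  qed (use y_less_u in \<open>auto intro: less_trans\<close>)
  then have "distribution_function g y = (SUP n. distribution_function g (u n))"
    unfolding distribution_function_def
    by (simp only:, intro SUP_emeasure_incseq[symmetric])
      (auto simp: incseq_def sets_lebesgue_superlevel g_measurable intro: le_less_trans[OF decseq_u])
  also have "\<dots> \<le> c"
    by (intro SUP_least above y_less_u)
  finally show ?thesis .
qed

lemma rearr_altdef: "rearr g t = Inf {y. 0 < y \<and> distribution_function g y \<le> ennreal t}"
  by (simp add: rearr_def distribution_function_def)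

lemma rearr_le_iff:
  assumes "g \<in> borel_measurable lebesgue"
  shows "rearr g t \<le> y \<longleftrightarrow> distribution_function g y \<le> ennreal t"
proof
  have antimono: "distribution_function g z \<le> distribution_function g w" if "w \<le> z" for w z
    using that by (intro distribution_function_mono_AE assms) auto
  show "rearr g t \<le> y" if "distribution_function g y \<le> ennreal t"
  proof (rule dense_ge)
    fix z assume "y < z"
    then have "0 < z" by (simp add: le_less_trans[of 0 y])
    moreover have "distribution_function g z \<le> ennreal t"
      using antimono[OF less_imp_le[OF \<open>y < z\<close>]] that by (rule order_trans)
    ultimately show "rearr g t \<le> z"
      unfolding rearr_altdef by (intro Inf_lower) auto
  qed
  show "distribution_function g y \<le> ennreal t" if "rearr g t \<le> y"
  proof (rule distribution_function_le_right_limit[OF assms])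
    fix z assume "y < z"
    with that have "rearr g t < z" by simp
    then obtain w where "w < z" "distribution_function g w \<le> ennreal t"
      unfolding rearr_altdef by (auto simp: Inf_less_iff)
    then show "distribution_function g z \<le> ennreal t"
      using antimono[OF less_imp_le] by (blast intro: order_trans)
  qed
qed

lemma less_rearr_iff:
  assumes "g \<in> borel_measurable lebesgue"
  shows "y < rearr g t \<longleftrightarrow> ennreal t < distribution_function g y"
  using rearr_le_iff[OF assms, of t y] by (simp add: not_le[symmetric])

lemma distribution_function_rearr_le:
  assumes "g \<in> borel_measurable lebesgue"
  shows "distribution_function g (rearr g t) \<le> ennreal t"
  using rearr_le_iff[OF assms, of t "rearr g t"] by simp

lemma rearr_mono_AE:
  assumes "f \<in> borel_measurable lebesgue" "g \<in> borel_measurable lebesgue"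
    and "AE x in lebesgue. f x \<le> g x"
  shows "rearr f t \<le> rearr g t"
proof -
  have "distribution_function f (rearr g t) \<le> distribution_function g (rearr g t)"
    using assms(3) by (intro distribution_function_mono_AE assms(2)) (auto elim: eventually_mono)
  also have "\<dots> \<le> ennreal t"
    by (rule distribution_function_rearr_le[OF assms(2)])
  finally show ?thesis by (simp add: rearr_le_iff assms(1))
qed

lemma rearr_cong_AE:
  assumes "f \<in> borel_measurable lebesgue" "g \<in> borel_measurable lebesgue"
    and "AE x in lebesgue. f x = g x"
  shows "rearr f = rearr g"
  using assms by (intro ext order_antisym rearr_mono_AE) auto

lemma rearr_antimono: "s \<le> t \<Longrightarrow> rearr g t \<le> rearr g s"
  unfolding rearr_def by (rule Inf_superset_mono) (auto intro: order_trans ennreal_leI)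

lemma rearr_cmult:
  assumes [measurable]: "g \<in> borel_measurable lebesgue" and "0 \<le> a"
  shows "rearr (\<lambda>x. ennreal a * g x) t = ennreal a * rearr g t"
proof (cases "a = 0")
  case True
  have "rearr (\<lambda>x::'a. 0) t \<le> 0"
    by (subst rearr_le_iff) (auto simp: distribution_function_def)
  with True show ?thesis by simp
next
  case False
  with assms have "0 < a" by simp
  have mult_le_iff: "ennreal a * z \<le> y \<longleftrightarrow> z \<le> y / ennreal a" for z y
    using \<open>0 < a\<close> by (subst ennreal_mult_le_mult_iff[symmetric, of "ennreal a" z])
      (auto simp: ennreal_times_divide mult.commute[of "ennreal a" y] ennreal_mult_divide_eq)
  have "rearr (\<lambda>x. ennreal a * g x) t \<le> y \<longleftrightarrow> ennreal a * rearr g t \<le> y" for y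
    using rearr_le_iff[of g t "y / ennreal a"]
    by (simp add: rearr_le_iff distribution_function_def mult_le_iff not_le[symmetric])
  then show ?thesis by (meson order_antisym order_refl)
qed

lemma rearr_const_add_le:
  assumes [measurable]: "v \<in> borel_measurable lebesgue"
  shows "rearr (\<lambda>x. a + v x) t \<le> a + rearr v t"
proof -
  have "distribution_function (\<lambda>x. a + v x) (a + rearr v t) \<le> distribution_function v (rearr v t)"
    by (intro distribution_function_mono_AE assms AE_I2) (meson add_left_mono not_le)
  also have "\<dots> \<le> ennreal t"
    by (rule distribution_function_rearr_le[OF assms])
  finally show ?thesis by (subst rearr_le_iff) auto
qed

lemma rearr_diff_const_le:
  assumes [measurable]: "g \<in> borel_measurable lebesgue"
  shows "rearr (\<lambda>x. g x - a) t \<le> rearr g t - a"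
proof -
  have "distribution_function (\<lambda>x. g x - a) (rearr g t - a) \<le> distribution_function g (rearr g t)"
    by (intro distribution_function_mono_AE assms AE_I2) (meson ennreal_minus_mono order_refl not_le)
  also have "\<dots> \<le> ennreal t"
    by (rule distribution_function_rearr_le[OF assms])
  finally show ?thesis by (subst rearr_le_iff) auto
qed

lemma le_rearrI:
  assumes g_measurable: "g \<in> borel_measurable lebesgue"
    and large: "ennreal t < emeasure lebesgue A" and ge: "\<And>x. x \<in> A \<Longrightarrow> y \<le> g x"
  shows "y \<le> rearr g t"
proof (rule ccontr)
  assume "\<not> y \<le> rearr g t"
  then have "A \<subseteq> {x. rearr g t < g x}"
    using ge by (force intro: less_le_trans)
  then have "emeasure lebesgue A \<le> distribution_function g (rearr g t)"
    unfolding distribution_function_def by (intro emeasure_mono sets_lebesgue_superlevel g_measurable)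
  also have "\<dots> \<le> ennreal t"
    by (rule distribution_function_rearr_le[OF g_measurable])
  finally show False using large by simp
qed

lemma borel_measurable_rearr:
  assumes "g \<in> borel_measurable lebesgue"
  shows "rearr g \<in> borel_measurable borel"
  by (rule borel_measurableI_greater) (simp add: less_rearr_iff[OF assms])

definition rearr_integral :: "('a::euclidean_space \<Rightarrow> ennreal) \<Rightarrow> real \<Rightarrow> ennreal" where
  "rearr_integral g t = set_nn_integral lborel {0<..<t} (rearr g)"

lemma rearr_integral_mono: "s \<le> t \<Longrightarrow> rearr_integral g s \<le> rearr_integral g t"
  unfolding rearr_integral_def by (intro nn_integral_mono) (auto simp: indicator_def)

lemma rearr_integral_mono_AE:
  assumes "f \<in> borel_measurable lebesgue" "g \<in> borel_measurable lebesgue"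
    and "AE x in lebesgue. f x \<le> g x"
  shows "rearr_integral f t \<le> rearr_integral g t"
  unfolding rearr_integral_def by (intro nn_integral_mono mult_right_mono rearr_mono_AE assms) auto

lemma mult_rearr_le_rearr_integral:
  assumes "0 \<le> t"
  shows "ennreal t * rearr g t \<le> rearr_integral g t"
proof -
  have "ennreal t * rearr g t = (\<integral>\<^sup>+s. rearr g t * indicator {0<..<t} s \<partial>lborel)"
    using assms by (subst nn_integral_cmult_indicator) (auto simp: mult.commute)
  also have "\<dots> \<le> rearr_integral g t"
    unfolding rearr_integral_def
    by (intro nn_integral_mono) (auto simp: indicator_def intro: rearr_antimono)
  finally show ?thesis .
qed

lemma rearr_integral_layer_cake:
  fixes g :: "'a::euclidean_space \<Rightarrow> ennreal"
  assumes "g \<in> borel_measurable lebesgue"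
  shows "rearr_integral g t
    = (\<integral>\<^sup>+y. min (ennreal t) (distribution_function g (ennreal y)) * indicator {0<..} y \<partial>lborel)"
proof -
  have "{s \<in> {0<..<t}. ennreal y < rearr g s}
      = {s. 0 < s \<and> ennreal s < min (ennreal t) (distribution_function g (ennreal y))}" for y
    by (auto simp: less_rearr_iff[OF assms] ennreal_less_iff)
  then show ?thesis
    unfolding rearr_integral_def using borel_measurable_rearr[OF assms]
    by (subst set_nn_integral_layer_cake)
      (simp_all add: sigma_finite_lborel emeasure_lborel_ennreal_less del: min_less_iff_conj)
qed

lemma sigma_finite_lebesgue: "sigma_finite_measure (lebesgue :: 'a::euclidean_space measure)"
  by (rule sigma_finite_measure_completion[OF sigma_finite_lborel])

lemma Hardy_Littlewood_set_nn_integral_le: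
  assumes g_measurable: "g \<in> borel_measurable lebesgue" and "A \<in> sets lebesgue"
    and "emeasure lebesgue A \<le> ennreal t"
  shows "set_nn_integral lebesgue A g \<le> rearr_integral g t"
proof -
  have "emeasure lebesgue {x \<in> A. ennreal y < g x}
      \<le> min (ennreal t) (distribution_function g (ennreal y))" for y
    unfolding distribution_function_def using sets_lebesgue_superlevel[OF g_measurable]
    by (intro min.boundedI order_trans[OF emeasure_mono assms(3)] emeasure_mono assms(2)) auto
  then show ?thesis
    unfolding rearr_integral_layer_cake[OF g_measurable]
      set_nn_integral_layer_cake[OF sigma_finite_lebesgue assms(1,2)]
    by (intro nn_integral_mono mult_right_mono) auto
qed

lemma rearr_integral_le_nn_integral:
  assumes "g \<in> borel_measurable lebesgue"
  shows "rearr_integral g t \<le> (\<integral>\<^sup>+x. g x \<partial>lebesgue)"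
proof -
  have "rearr_integral g t \<le> set_nn_integral lebesgue UNIV g"
    unfolding rearr_integral_layer_cake[OF assms]
    by (subst set_nn_integral_layer_cake[OF sigma_finite_lebesgue assms])
      (auto simp: distribution_function_def intro!: nn_integral_mono mult_right_mono)
  then show ?thesis by simp
qed

lemma rearr_integral_const_add_le:
  assumes v_measurable: "v \<in> borel_measurable lebesgue" and "0 \<le> t"
  shows "rearr_integral (\<lambda>x. a + v x) t \<le> ennreal t * a + rearr_integral v t"
proof -
  note [measurable] = borel_measurable_rearr[OF v_measurable]
  have "rearr_integral (\<lambda>x. a + v x) t
      \<le> (\<integral>\<^sup>+s. a * indicator {0<..<t} s + rearr v s * indicator {0<..<t} s \<partial>lborel)"
    unfolding rearr_integral_def using rearr_const_add_le[OF v_measurable, of a]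
    by (intro nn_integral_mono) (auto simp: indicator_def)
  also have "\<dots> = ennreal t * a + rearr_integral v t"
    unfolding rearr_integral_def using \<open>0 \<le> t\<close>
    by (simp add: nn_integral_add nn_integral_cmult_indicator mult.commute)
  finally show ?thesis .
qed

lemma mult_rearr_add_nn_integral_excess_le:
  assumes g_measurable [measurable]: "g \<in> borel_measurable lebesgue" and "0 < t"
  shows "ennreal t * rearr g t + (\<integral>\<^sup>+x. (g x - rearr g t) \<partial>lebesgue) \<le> rearr_integral g t"
proof (cases "rearr g t = top")
  case True
  with mult_rearr_le_rearr_integral[of t g] \<open>0 < t\<close> show ?thesis
    by (simp add: ennreal_mult_top top_unique)
next
  case False
  define level where "level = rearr g t"
  define excess where "excess x = g x - level" for x
  have [measurable]: "excess \<in> borel_measurable lebesgue" unfolding excess_def by measurable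
  note [measurable] = borel_measurable_rearr[OF g_measurable]
  have supp: "excess x * indicator {x. level < g x} x = excess x" for x
    using False
    by (auto simp: indicator_def excess_def level_def diff_eq_0_iff_ennreal not_less top.not_eq_extremum
        intro: le_less_trans)
  have "(\<integral>\<^sup>+x. excess x \<partial>lebesgue) = set_nn_integral lebesgue {x. level < g x} excess"
    by (simp add: supp)
  also have "\<dots> \<le> rearr_integral excess t"
    using distribution_function_rearr_le[OF g_measurable, of t]
    by (intro Hardy_Littlewood_set_nn_integral_le sets_lebesgue_superlevel)
      (simp_all add: level_def distribution_function_def)
  also have "\<dots> \<le> (\<integral>\<^sup>+s. (rearr g s - level) * indicator {0<..<t} s \<partial>lborel)"
    unfolding rearr_integral_def excess_def
    by (intro nn_integral_mono mult_right_mono rearr_diff_const_le g_measurable) simp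
  finally have "ennreal t * level + (\<integral>\<^sup>+x. excess x \<partial>lebesgue)
      \<le> ennreal t * level + (\<integral>\<^sup>+s. (rearr g s - level) * indicator {0<..<t} s \<partial>lborel)"
    by (rule add_left_mono)
  also have "\<dots> = (\<integral>\<^sup>+s. level * indicator {0<..<t} s
      + (rearr g s - level) * indicator {0<..<t} s \<partial>lborel)"
    using \<open>0 < t\<close> by (simp add: nn_integral_add nn_integral_cmult_indicator mult.commute)
  also have "\<dots> = rearr_integral g t"
    unfolding rearr_integral_def
    by (intro nn_integral_cong)
      (auto simp: indicator_def level_def add_diff_inverse_ennreal rearr_antimono)
  finally show ?thesis unfolding excess_def level_def .
qed

lemma rearr2_eq_rearr_integral: "rearr2 g t = rearr_integral g t / ennreal t"
  by (simp add: rearr2_def rearr_integral_def)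

lemma mult_rearr2:
  assumes "0 < t"
  shows "ennreal t * rearr2 g t = rearr_integral g t"
  using assms
  by (simp add: rearr2_eq_rearr_integral ennreal_times_divide mult.commute[of "ennreal t"]
      ennreal_mult_divide_eq)

lemma rearr2_leI:
  assumes "rearr_integral g t \<le> ennreal t * y" "0 < t"
  shows "rearr2 g t \<le> y"
  using divide_right_mono_ennreal[OF assms(1), of "ennreal t"] \<open>0 < t\<close>
  by (simp add: rearr2_eq_rearr_integral mult.commute[of "ennreal t"] ennreal_mult_divide_eq)

lemma rearr_le_rearr2:
  assumes "0 < t"
  shows "rearr g t \<le> rearr2 g t"
  using mult_rearr_le_rearr_integral[of t g] assms
  by (simp add: mult_rearr2[symmetric] ennreal_mult_le_mult_iff)

lemma rearr2_cmult:
  assumes "g \<in> borel_measurable lebesgue" and "0 \<le> a"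
  shows "rearr2 (\<lambda>x. ennreal a * g x) t = ennreal a * rearr2 g t"
  using borel_measurable_rearr[OF assms(1)]
  by (simp add: rearr2_def rearr_cmult[OF assms] mult.assoc nn_integral_cmult ennreal_times_divide)

lemma rearr2_mono_AE:
  assumes "f \<in> borel_measurable lebesgue" "g \<in> borel_measurable lebesgue"
    and "AE x in lebesgue. f x \<le> g x"
  shows "rearr2 f t \<le> rearr2 g t"
  unfolding rearr2_eq_rearr_integral by (intro divide_right_mono_ennreal rearr_integral_mono_AE assms)

section \<open>Convolutions\<close>

definition nn_convolution :: "('a::euclidean_space \<Rightarrow> ennreal) \<Rightarrow> ('a \<Rightarrow> ennreal) \<Rightarrow> 'a \<Rightarrow> ennreal" where
  "nn_convolution k g x = (\<integral>\<^sup>+y. k (x - y) * g y \<partial>lborel)"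

lemma borel_measurable_nn_convolution [measurable]:
  assumes [measurable]: "k \<in> borel_measurable borel" "g \<in> borel_measurable borel"
  shows "nn_convolution k g \<in> borel_measurable borel"
  unfolding nn_convolution_def by measurable

lemma nn_integral_lborel_affine:
  fixes f :: "'a::euclidean_space \<Rightarrow> ennreal"
  assumes [measurable]: "f \<in> borel_measurable borel" and "c \<noteq> 0"
  shows "(\<integral>\<^sup>+x. f x \<partial>lborel) = ennreal (\<bar>c\<bar> ^ DIM('a)) * (\<integral>\<^sup>+x. f (a + c *\<^sub>R x) \<partial>lborel)"
  by (subst lborel_affine[OF \<open>c \<noteq> 0\<close>, of a])
    (simp add: nn_integral_density nn_integral_distr nn_integral_cmult)

lemma nn_integral_nn_convolution:
  fixes k g :: "'a::euclidean_space \<Rightarrow> ennreal"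
  assumes [measurable]: "k \<in> borel_measurable borel" "g \<in> borel_measurable borel"
  shows "(\<integral>\<^sup>+x. nn_convolution k g x \<partial>lborel) = (\<integral>\<^sup>+x. k x \<partial>lborel) * (\<integral>\<^sup>+y. g y \<partial>lborel)"
proof -
  have "(\<integral>\<^sup>+x. nn_convolution k g x \<partial>lborel) = (\<integral>\<^sup>+y. (\<integral>\<^sup>+x. k (x - y) * g y \<partial>lborel) \<partial>lborel)"
    unfolding nn_convolution_def by (rule lborel_pair.Fubini'[symmetric]) (simp add: case_prod_unfold)
  also have "\<dots> = (\<integral>\<^sup>+y. (\<integral>\<^sup>+x. k x \<partial>lborel) * g y \<partial>lborel)"
    using nn_integral_lborel_affine[of k 1 "- _"] by (simp add: nn_integral_multc)
  finally show ?thesis by (simp add: nn_integral_cmult)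
qed

lemma nn_convolution_const_add:
  fixes k g :: "'a::euclidean_space \<Rightarrow> ennreal"
  assumes [measurable]: "k \<in> borel_measurable borel" "g \<in> borel_measurable borel"
  shows "nn_convolution k (\<lambda>y. a + g y) x = (\<integral>\<^sup>+z. k z \<partial>lborel) * a + nn_convolution k g x"
  using nn_integral_lborel_affine[of k "-1" x]
  by (simp add: nn_convolution_def distrib_left nn_integral_add nn_integral_multc)

lemma nn_convolution_mono: "(\<And>y. f y \<le> g y) \<Longrightarrow> nn_convolution k f x \<le> nn_convolution k g x"
  unfolding nn_convolution_def by (intro nn_integral_mono mult_left_mono) auto

lemma rearr_integral_nn_convolution_le:
  fixes k g :: "'a::euclidean_space \<Rightarrow> ennreal"
  assumes [measurable]: "k \<in> borel_measurable borel" "g \<in> borel_measurable borel" and "0 < t"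
  shows "rearr_integral (nn_convolution k g) t \<le> (\<integral>\<^sup>+x. k x \<partial>lborel) * rearr_integral g t"
proof -
  define level where "level = rearr g t"
  define excess where "excess x = g x - level" for x
  define mass where "mass = (\<integral>\<^sup>+x. k x \<partial>lborel)"
  have [measurable]: "excess \<in> borel_measurable borel" unfolding excess_def by measurable
  have "g x \<le> level + excess x" for x
    by (auto simp: excess_def add_diff_self_ennreal)
  then have "nn_convolution k g x \<le> mass * level + nn_convolution k excess x" for x
    unfolding mass_def by (subst nn_convolution_const_add[symmetric]) (auto intro: nn_convolution_mono)
  then have "rearr_integral (nn_convolution k g) t
      \<le> rearr_integral (\<lambda>x. mass * level + nn_convolution k excess x) t"
    by (intro rearr_integral_mono_AE AE_I2 borel_measurable_lebesgueI) measurable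
  also have "\<dots> \<le> ennreal t * (mass * level) + rearr_integral (nn_convolution k excess) t"
    using \<open>0 < t\<close> by (intro rearr_integral_const_add_le borel_measurable_lebesgueI) auto
  also have "\<dots> \<le> ennreal t * (mass * level) + mass * (\<integral>\<^sup>+x. excess x \<partial>lborel)"
    using rearr_integral_le_nn_integral[of "nn_convolution k excess" t]
    by (intro add_left_mono)
      (simp add: borel_measurable_lebesgueI nn_integral_completion nn_integral_nn_convolution mass_def)
  also have "\<dots> = mass * (ennreal t * level + (\<integral>\<^sup>+x. excess x \<partial>lborel))"
    by (simp add: algebra_simps)
  also have "\<dots> \<le> mass * rearr_integral g t"
    using mult_rearr_add_nn_integral_excess_le[of g t] \<open>0 < t\<close>
    by (intro mult_left_mono)
      (simp_all add: borel_measurable_lebesgueI nn_integral_completion level_def excess_def)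
  finally show ?thesis by (simp add: mass_def)
qed

section \<open>Radial functions\<close>

lemma measure_eqI_atMost:
  fixes M N :: "real measure"
  assumes sets: "sets M = sets borel" "sets N = sets borel"
    and fin: "\<And>a. emeasure M {..a} < \<infinity>"
    and eq: "\<And>a. emeasure M {..a} = emeasure N {..a}"
  shows "M = N"
proof (rule measure_eqI_generator_eq[where E = "range atMost" and \<Omega> = UNIV and A = "\<lambda>i. {..real i}"])
  show "Int_stable (range atMost :: real set set)"
    by (auto simp: Int_stable_def Int_atMost)
  show "sets M = sigma_sets UNIV (range atMost)" "sets N = sigma_sets UNIV (range atMost)"
    using sets by (simp_all add: borel_eq_atMost)
  show "(\<Union>i. {..real i}) = UNIV"
    by (auto simp: real_arch_simple)
  show "emeasure M {..real i} \<noteq> \<infinity>" for i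
    using fin[of "real i"] by simp
qed (use eq in auto)

definition ball_vol :: "nat \<Rightarrow> real \<Rightarrow> real" where
  "ball_vol n r = unit_ball_vol n * r ^ n"

lemma ball_vol_le_iff:
  assumes "0 < n" "0 \<le> r" "0 \<le> s"
  shows "ball_vol n r \<le> ball_vol n s \<longleftrightarrow> r \<le> s"
  using assms by (simp add: ball_vol_def power_mono_iff)

lemma ball_vol_less_iff:
  assumes "0 < n" "0 \<le> r" "0 \<le> s"
  shows "ball_vol n r < ball_vol n s \<longleftrightarrow> r < s"
  using ball_vol_le_iff[OF assms(1,3,2)] by (simp add: not_le[symmetric])

lemma ball_vol_eqE:
  assumes "0 < n" "0 \<le> v"
  obtains r where "0 \<le> r" "ball_vol n r = v"
proof
  show "0 \<le> root n (v / unit_ball_vol n)" using assms by simp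
  show "ball_vol n (root n (v / unit_ball_vol n)) = v"
    using assms unit_ball_vol_pos[of "real n"] by (simp add: ball_vol_def less_imp_neq[symmetric])
qed

lemma distr_ball_vol_norm_lborel:
  "distr lborel borel (\<lambda>x::'a::euclidean_space. ball_vol DIM('a) (norm x))
   = density lborel (indicator {0<..})"
    (is "?L = ?R")
proof (rule measure_eqI_atMost)
  fix a :: real
  have emeasure_distr_atMost:
    "emeasure ?L {..a} = emeasure lborel {x::'a. ball_vol DIM('a) (norm x) \<le> a}"
    by (subst emeasure_distr) (auto simp: ball_vol_def vimage_def)
  have emeasure_density_atMost: "emeasure ?R {..a} = emeasure lborel {0<..a}"
    by (subst emeasure_density) (auto simp: indicator_inter_arith[symmetric] greaterThanAtMost_def)
  have "emeasure ?L {..a} = ennreal a"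
  proof (cases "0 \<le> a")
    case True
    then obtain r where r_nonneg: "0 \<le> r" and r_vol: "ball_vol DIM('a) r = a"
      using ball_vol_eqE[of "DIM('a)" a] by auto
    then have "{x::'a. ball_vol DIM('a) (norm x) \<le> a} = cball 0 r"
      by (auto simp: ball_vol_le_iff simp flip: r_vol)
    with emeasure_distr_atMost r_nonneg r_vol show ?thesis
      by (simp add: emeasure_cball flip: ball_vol_def)
  next
    case False
    then have "{x::'a. ball_vol DIM('a) (norm x) \<le> a} = {}"
      by (auto simp: ball_vol_def not_le intro: less_le_trans)
    with emeasure_distr_atMost False show ?thesis by (simp add: ennreal_neg)
  qed
  then show "emeasure ?L {..a} < \<infinity>" "emeasure ?L {..a} = emeasure ?R {..a}"
    using emeasure_density_atMost by (cases "0 \<le> a"; simp add: ennreal_neg)+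
qed auto

lemma nn_integral_ball_vol_norm:
  assumes [measurable]: "F \<in> borel_measurable borel"
  shows "(\<integral>\<^sup>+x. F (ball_vol DIM('a) (norm (x::'a::euclidean_space))) \<partial>lborel)
    = set_nn_integral lborel {0<..} F"
proof -
  have [measurable]: "(\<lambda>x::'a. ball_vol DIM('a) (norm x)) \<in> borel_measurable borel"
    unfolding ball_vol_def by measurable
  have "(\<integral>\<^sup>+x. F (ball_vol DIM('a) (norm (x::'a))) \<partial>lborel)
      = (\<integral>\<^sup>+r. F r \<partial>distr lborel borel (\<lambda>x::'a. ball_vol DIM('a) (norm x)))"
    by (simp add: nn_integral_distr)
  then show ?thesis
    by (simp add: distr_ball_vol_norm_lborel nn_integral_density mult.commute)
qed

lemma set_nn_integral_power_Icc:
  assumes "0 < n" "0 \<le> a"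
  shows "set_nn_integral lborel {0..a} (\<lambda>r. ennreal (real n * r ^ (n - 1))) = ennreal (a ^ n)"
proof -
  have "set_nn_integral lborel {0..a} (\<lambda>r. ennreal (real n * r ^ (n - 1))) = ennreal (a ^ n - 0 ^ n)"
    using assms DERIV_pow[of n] by (intro nn_integral_FTC_Icc) auto
  with assms show ?thesis by simp
qed

lemma distr_norm_lborel:
  "distr lborel borel (norm :: 'a::euclidean_space \<Rightarrow> real)
   = density lborel
      (\<lambda>r. ennreal (unit_ball_vol DIM('a) * (real DIM('a) * r ^ (DIM('a) - 1))) * indicator {0..} r)"
    (is "?L = ?R")
proof (rule measure_eqI_atMost)
  fix a :: real
  have "norm -` {..a} = (if 0 \<le> a then cball 0 a else {} :: 'a set)"
    by (auto intro: order_trans[OF norm_ge_zero])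
  then have emeasure_distr_atMost: "emeasure ?L {..a}
      = (if 0 \<le> a then ennreal (unit_ball_vol DIM('a)) * ennreal (a ^ DIM('a)) else 0)"
    by (subst emeasure_distr) (auto simp: emeasure_cball ennreal_mult')
  then show "emeasure ?L {..a} < \<infinity>" by (simp add: ennreal_mult_less_top)
  have "emeasure ?R {..a} = (\<integral>\<^sup>+r. ennreal (unit_ball_vol DIM('a)) *
      (ennreal (real DIM('a) * r ^ (DIM('a) - 1)) * indicator {0..a} r) \<partial>lborel)"
    by (subst emeasure_density) (auto intro!: nn_integral_cong simp: indicator_def ennreal_mult')
  also have "\<dots> = ennreal (unit_ball_vol DIM('a)) *
      set_nn_integral lborel {0..a} (\<lambda>r. ennreal (real DIM('a) * r ^ (DIM('a) - 1)))"
    by (rule nn_integral_cmult) measurable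
  also have "\<dots> = emeasure ?L {..a}"
    using emeasure_distr_atMost
    by (cases "0 \<le> a") (simp_all add: set_nn_integral_power_Icc del: One_nat_def)
  finally show "emeasure ?L {..a} = emeasure ?R {..a}" by simp
qed auto

lemma nn_integral_norm:
  assumes [measurable]: "F \<in> borel_measurable borel"
  shows "(\<integral>\<^sup>+x. F (norm (x::'a::euclidean_space)) \<partial>lborel)
    = (\<integral>\<^sup>+r. ennreal (unit_ball_vol DIM('a) * (real DIM('a) * r ^ (DIM('a) - 1)))
        * indicator {0..} r * F r \<partial>lborel)"
proof -
  have "(\<integral>\<^sup>+x. F (norm (x::'a)) \<partial>lborel) = (\<integral>\<^sup>+r. F r \<partial>distr lborel borel (norm :: 'a \<Rightarrow> real))"
    by (simp add: nn_integral_distr)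
  then show ?thesis
    by (simp add: distr_norm_lborel nn_integral_density)
qed

definition radial_rearr :: "('a::euclidean_space \<Rightarrow> ennreal) \<Rightarrow> 'a \<Rightarrow> ennreal" where
  "radial_rearr g x = rearr g (ball_vol DIM('a) (norm x))"

lemma borel_measurable_radial_rearr:
  assumes "g \<in> borel_measurable lebesgue"
  shows "radial_rearr g \<in> borel_measurable borel"
  using borel_measurable_rearr[OF assms] unfolding radial_rearr_def ball_vol_def by measurable

lemma distribution_function_radial_rearr:
  fixes g :: "'a::euclidean_space \<Rightarrow> ennreal"
  assumes g_measurable: "g \<in> borel_measurable lebesgue"
  shows "distribution_function (radial_rearr g) = distribution_function g"
proof
  fix y
  let ?d = "distribution_function g y"
  have "distribution_function (radial_rearr g) y = emeasure lborel {x. y < radial_rearr g x}"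
    unfolding distribution_function_def using borel_measurable_radial_rearr[OF g_measurable] by simp
  also have "\<dots> = emeasure (distr lborel borel (\<lambda>x::'a. ball_vol DIM('a) (norm x))) {s. ennreal s < ?d}"
    by (subst emeasure_distr)
      (auto simp: radial_rearr_def less_rearr_iff[OF g_measurable] ball_vol_def vimage_def)
  also have "\<dots> = emeasure lborel ({0<..} \<inter> {s. ennreal s < ?d})"
    unfolding distr_ball_vol_norm_lborel
    by (subst emeasure_density) (auto simp: indicator_inter_arith[symmetric])
  also have "\<dots> = ?d"
    by (simp add: Int_def emeasure_lborel_ennreal_less)
  finally show "distribution_function (radial_rearr g) y = ?d" .
qed

lemma rearr_radial_rearr: "g \<in> borel_measurable lebesgue \<Longrightarrow> rearr (radial_rearr g) = rearr g"
  by (simp add: rearr_altdef distribution_function_radial_rearr fun_eq_iff)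

lemma set_nn_integral_ball_radial_rearr:
  fixes g :: "'a::euclidean_space \<Rightarrow> ennreal"
  assumes g_measurable: "g \<in> borel_measurable lebesgue" and "0 \<le> r"
  shows "set_nn_integral lebesgue (ball 0 r) (radial_rearr g) = rearr_integral g (ball_vol DIM('a) r)"
proof -
  note [measurable] = borel_measurable_rearr[OF g_measurable]
  let ?F = "\<lambda>s. rearr g s * indicator {..<ball_vol DIM('a) r} s"
  have "set_nn_integral lebesgue (ball 0 r) (radial_rearr g)
      = (\<integral>\<^sup>+x. ?F (ball_vol DIM('a) (norm (x::'a))) \<partial>lborel)"
    unfolding nn_integral_completion
    by (intro nn_integral_cong) (auto simp: radial_rearr_def indicator_def ball_vol_less_iff \<open>0 \<le> r\<close>)
  also have "\<dots> = set_nn_integral lborel {0<..} ?F"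
    by (rule nn_integral_ball_vol_norm) measurable
  also have "\<dots> = rearr_integral g (ball_vol DIM('a) r)"
    unfolding rearr_integral_def by (intro nn_integral_cong) (auto simp: indicator_def)
  finally show ?thesis .
qed

section \<open>The class \<open>B\<^sub>n(\<infinity>)\<close>\<close>

lemma class_B_pos: "class_B n \<Phi> \<Longrightarrow> 0 < r \<Longrightarrow> 0 < \<Phi> r"
  and class_B_antimono: "class_B n \<Phi> \<Longrightarrow> 0 < r \<Longrightarrow> r \<le> s \<Longrightarrow> \<Phi> s \<le> \<Phi> r"
  by (auto simp: class_B_def)

lemma class_B_integral_bound:
  assumes "class_B n \<Phi>"
  obtains C where "0 < C" "\<And>r. 0 < r \<Longrightarrow>
    set_nn_integral lborel {0<..<r} (\<lambda>s. ennreal (\<Phi> s * s ^ (n - 1))) \<le> ennreal (C * \<Phi> r * r ^ n)"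
  using assms unfolding class_B_def by blast

lemma class_B_measurable:
  assumes "class_B n \<Phi>"
  shows "(\<lambda>s. ennreal (\<Phi> s) * indicator {0<..<R} s) \<in> borel_measurable borel"
proof -
  have "continuous_on {0<..<R} \<Phi>"
    using assms by (auto simp: class_B_def intro: continuous_on_subset)
  then have "(\<lambda>s. indicator {0<..<R} s *\<^sub>R \<Phi> s) \<in> borel_measurable borel"
    by (intro borel_measurable_continuous_on_indicator) auto
  then have "(\<lambda>s. ennreal (indicator {0<..<R} s *\<^sub>R \<Phi> s)) \<in> borel_measurable borel"
    by measurable
  moreover have "ennreal (indicator {0<..<R} s *\<^sub>R \<Phi> s) = ennreal (\<Phi> s) * indicator {0<..<R} s" for s
    by (simp add: indicator_def)
  ultimately show ?thesis by simp
qed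

lemma class_B_doubling:
  assumes \<Phi>_class_B: "class_B n \<Phi>" and "0 < n" "1 \<le> l"
  obtains c where "0 < c" "\<And>r. 0 < r \<Longrightarrow> \<Phi> r \<le> c * \<Phi> (l * r)"
proof -
  obtain C where C_pos: "0 < C" and C_bound: "\<And>r. 0 < r \<Longrightarrow>
      set_nn_integral lborel {0<..<r} (\<lambda>s. ennreal (\<Phi> s * s ^ (n - 1))) \<le> ennreal (C * \<Phi> r * r ^ n)"
    using class_B_integral_bound[OF \<Phi>_class_B] by blast
  show ?thesis
  proof
    show "0 < C * (2 * l) ^ n" using C_pos \<open>1 \<le> l\<close> by simp
    fix r :: real assume r_pos: "0 < r"
    with \<open>1 \<le> l\<close> have lr_pos: "0 < l * r" and r_le_lr: "r \<le> l * r" by auto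
    have pointwise: "\<Phi> r * (r / 2) ^ (n - 1) \<le> \<Phi> s * s ^ (n - 1)" if "r / 2 < s" "s < r" for s
      using that r_pos
      by (intro mult_mono power_mono class_B_antimono[OF \<Phi>_class_B]
          less_imp_le[OF class_B_pos[OF \<Phi>_class_B]])
        auto
    have "(r / 2) ^ n = (r / 2) ^ (n - 1) * (r / 2)"
      by (rule power_minus_mult[OF \<open>0 < n\<close>, symmetric])
    then have "ennreal (\<Phi> r * (r / 2) ^ n) = ennreal (\<Phi> r * (r / 2) ^ (n - 1)) * ennreal (r / 2)"
      using r_pos by (simp only: mult.assoc ennreal_mult''[symmetric])
    also have "\<dots> = (\<integral>\<^sup>+s. ennreal (\<Phi> r * (r / 2) ^ (n - 1)) * indicator {r/2<..<r} s \<partial>lborel)"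
      using r_pos by (subst nn_integral_cmult_indicator) auto
    also have "\<dots> \<le> set_nn_integral lborel {0<..<l * r} (\<lambda>s. ennreal (\<Phi> s * s ^ (n - 1)))"
      using r_pos pointwise less_le_trans[OF _ r_le_lr]
      by (intro nn_integral_mono) (auto simp: indicator_def intro!: ennreal_leI)
    also have "\<dots> \<le> ennreal (C * \<Phi> (l * r) * (l * r) ^ n)"
      by (rule C_bound[OF lr_pos])
    finally have "\<Phi> r * (r / 2) ^ n \<le> C * \<Phi> (l * r) * (l * r) ^ n"
      using C_pos class_B_pos[OF \<Phi>_class_B lr_pos] lr_pos by simp
    then show "\<Phi> r \<le> C * (2 * l) ^ n * \<Phi> (l * r)"
      using r_pos by (simp add: power_mult_distrib power_divide field_simps)
  qed
qed

lemma class_B_root_ball_vol_le: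
  assumes \<Phi>_class_B: "class_B n \<Phi>" and "0 < n" "0 < k"
  obtains c where "0 < c" "\<And>r. 0 < r \<Longrightarrow> \<Phi> (root n (ball_vol n r)) \<le> c * \<Phi> (k * r)"
proof -
  define w where "w = root n (unit_ball_vol n)"
  have w_pos: "0 < w" using \<open>0 < n\<close> by (simp add: w_def)
  define l where "l = max 1 (k / w)"
  have "1 \<le> l" "k / w \<le> l" by (simp_all add: l_def)
  then have "k \<le> l * w" using w_pos by (simp add: pos_divide_le_eq)
  obtain c where c_pos: "0 < c" and c_doubling: "\<And>r. 0 < r \<Longrightarrow> \<Phi> r \<le> c * \<Phi> (l * r)"
    using class_B_doubling[OF \<Phi>_class_B \<open>0 < n\<close> \<open>1 \<le> l\<close>] by blast
  show ?thesis
  proof (rule that[OF c_pos])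
    fix r :: real assume r_pos: "0 < r"
    have root_ball_vol: "root n (ball_vol n r) = w * r"
      using r_pos \<open>0 < n\<close> by (simp add: real_root_mult real_root_power_cancel ball_vol_def w_def)
    have "k * r \<le> l * (w * r)"
      using r_pos mult_right_mono[OF \<open>k \<le> l * w\<close>, of r] by (simp add: mult.assoc)
    then have "c * \<Phi> (l * (w * r)) \<le> c * \<Phi> (k * r)"
      using c_pos r_pos \<open>0 < k\<close> by (intro mult_left_mono class_B_antimono[OF \<Phi>_class_B]) auto
    with c_doubling[of "w * r"] r_pos w_pos show "\<Phi> (root n (ball_vol n r)) \<le> c * \<Phi> (k * r)"
      by (simp add: root_ball_vol)
  qed
qed

definition radial_kernel :: "(real \<Rightarrow> real) \<Rightarrow> real \<Rightarrow> 'a::euclidean_space \<Rightarrow> ennreal" where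
  "radial_kernel \<Phi> R z = ennreal (\<Phi> (norm z)) * indicator {0<..<R} (norm z)"

lemma borel_measurable_radial_kernel:
  assumes "class_B n \<Phi>"
  shows "radial_kernel \<Phi> R \<in> borel_measurable borel"
  unfolding radial_kernel_def
  by (rule measurable_compose[OF borel_measurable_norm class_B_measurable[OF assms]])

lemma nn_integral_radial_kernel_le:
  assumes \<Phi>_class_B: "class_B DIM('a::euclidean_space) \<Phi>"
  obtains D where "0 < D"
    "\<And>R. 0 < R \<Longrightarrow> (\<integral>\<^sup>+z. radial_kernel \<Phi> R (z::'a) \<partial>lborel) \<le> ennreal (D * \<Phi> R * R ^ DIM('a))"
proof -
  obtain C where C_pos: "0 < C" and C_bound: "\<And>r. 0 < r \<Longrightarrow>
      set_nn_integral lborel {0<..<r} (\<lambda>s. ennreal (\<Phi> s * s ^ (DIM('a) - 1)))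
        \<le> ennreal (C * \<Phi> r * r ^ DIM('a))"
    using class_B_integral_bound[OF \<Phi>_class_B] by blast
  let ?area = "unit_ball_vol DIM('a) * real DIM('a)"
  show ?thesis
  proof
    show "0 < ?area * C" using C_pos by simp
    fix R :: real assume "0 < R"
    note [measurable] = class_B_measurable[OF \<Phi>_class_B, of R]
    have "(\<integral>\<^sup>+z. radial_kernel \<Phi> R (z::'a) \<partial>lborel)
        = (\<integral>\<^sup>+r. ennreal ?area *
            (ennreal (r ^ (DIM('a) - 1)) * (ennreal (\<Phi> r) * indicator {0<..<R} r)) \<partial>lborel)"
      unfolding radial_kernel_def
      by (subst nn_integral_norm[OF class_B_measurable[OF \<Phi>_class_B]])
        (auto intro!: nn_integral_cong simp: indicator_def ennreal_mult' mult.assoc)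
    also have "\<dots> = ennreal ?area *
        (\<integral>\<^sup>+r. ennreal (r ^ (DIM('a) - 1)) * (ennreal (\<Phi> r) * indicator {0<..<R} r) \<partial>lborel)"
      by (rule nn_integral_cmult) measurable
    also have "(\<integral>\<^sup>+r. ennreal (r ^ (DIM('a) - 1)) * (ennreal (\<Phi> r) * indicator {0<..<R} r) \<partial>lborel)
        = set_nn_integral lborel {0<..<R} (\<lambda>s. ennreal (\<Phi> s * s ^ (DIM('a) - 1)))"
      by (intro nn_integral_cong) (auto simp: indicator_def ennreal_mult'' mult.commute)
    also have "ennreal ?area * \<dots> \<le> ennreal ?area * ennreal (C * \<Phi> R * R ^ DIM('a))"
      by (intro mult_left_mono C_bound \<open>0 < R\<close>) simp
    also have "\<dots> = ennreal (?area * C * \<Phi> R * R ^ DIM('a))"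
      by (simp add: ennreal_mult'[symmetric] mult.assoc)
    finally show "(\<integral>\<^sup>+z. radial_kernel \<Phi> R (z::'a) \<partial>lborel) \<le> ennreal (?area * C * \<Phi> R * R ^ DIM('a))" .
  qed
qed

lemma mult_set_nn_integral_ball_le_nn_convolution:
  assumes \<Phi>_class_B: "class_B n \<Phi>" and "0 < r" and r_le_R: "r \<le> R"
    and [measurable]: "g \<in> borel_measurable borel"
  shows "ennreal (\<Phi> r) * set_nn_integral lborel (ball x r) g \<le> nn_convolution (radial_kernel \<Phi> R) g x"
proof -
  have [measurable]: "ball x r \<in> sets borel" by simp
  have "ennreal (\<Phi> r) * set_nn_integral lborel (ball x r) g
      = (\<integral>\<^sup>+y. ennreal (\<Phi> r) * (g y * indicator (ball x r) y) \<partial>lborel)"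
    by (rule nn_integral_cmult[symmetric]) simp
  also have "\<dots> \<le> (\<integral>\<^sup>+y. radial_kernel \<Phi> R (x - y) * g y \<partial>lborel)"
  proof (rule nn_integral_mono_AE)
    have "AE y in lborel. y \<noteq> x" by (rule AE_lborel_singleton)
    then show "AE y in lborel. ennreal (\<Phi> r) * (g y * indicator (ball x r) y)
        \<le> radial_kernel \<Phi> R (x - y) * g y"
    proof eventually_elim
      case (elim y)
      with r_le_R class_B_antimono[OF \<Phi>_class_B, of "norm (x - y)" r] show ?case
        by (auto simp: radial_kernel_def indicator_def dist_norm intro!: mult_right_mono ennreal_leI)
    qed
  qed
  finally show ?thesis unfolding nn_convolution_def .
qed

section \<open>The generalized fractional maximal function\<close>

lemma maxfn_mono_AE:
  assumes "AE x in lebesgue. \<bar>f x\<bar> \<le> \<bar>g x\<bar>"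
  shows "maxfn \<Phi> f x \<le> maxfn \<Phi> g x"
  unfolding maxfn_def using assms
  by (intro SUP_mono' mult_left_mono nn_integral_mono_AE) (auto intro!: mult_right_mono ennreal_leI)

lemma maxfn_cmult:
  assumes [measurable]: "f \<in> borel_measurable lebesgue" and "0 \<le> a"
  shows "maxfn \<Phi> (\<lambda>x. a * f x) = (\<lambda>x. ennreal a * maxfn \<Phi> f x)"
proof
  fix x
  have "set_nn_integral lebesgue (ball x r) (\<lambda>y. ennreal \<bar>a * f y\<bar>)
      = ennreal a * set_nn_integral lebesgue (ball x r) (\<lambda>y. ennreal \<bar>f y\<bar>)" for r
  proof -
    have [measurable]: "ball x r \<in> sets lebesgue" by simp
    show ?thesis
      using \<open>0 \<le> a\<close>
      by (subst nn_integral_cmult[symmetric]) (auto simp: abs_mult ennreal_mult' mult.assoc)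
  qed
  then show "maxfn \<Phi> (\<lambda>x. a * f x) x = ennreal a * maxfn \<Phi> f x"
    unfolding maxfn_def SUP_mult_left_ennreal by (simp add: ac_simps)
qed

lemma mult_set_nn_integral_le_maxfn:
  assumes "0 < r" "A \<subseteq> ball x r"
  shows "ennreal (\<Phi> r) * set_nn_integral lebesgue A (\<lambda>y. ennreal \<bar>f y\<bar>) \<le> maxfn \<Phi> f x"
  unfolding maxfn_def using assms
  by (intro SUP_upper2[of r] mult_left_mono nn_integral_mono) (auto simp: indicator_def)

lemma set_nn_integral_ball_eq_SUP:
  fixes M :: "'a::metric_space measure"
  assumes g_measurable: "g \<in> borel_measurable M" and balls: "\<And>s. ball x s \<in> sets M"
  shows "set_nn_integral M (ball x r) g = (SUP s\<in>{..<r}. set_nn_integral M (ball x s) g)"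
proof (rule antisym)
  let ?B = "\<lambda>n::nat. ball x (r - 1 / real (Suc n))"
  have eq_emeasure: "set_nn_integral M (ball x s) g = emeasure (density M g) (ball x s)" for s
    using g_measurable balls by (simp add: emeasure_density)
  have "ball x r = (\<Union>n. ?B n)"
  proof (intro set_eqI iffI)
    fix z assume "z \<in> ball x r"
    then obtain n where "1 / real (Suc n) < r - dist x z"
      using reals_Archimedean[of "r - dist x z"] by (auto simp: inverse_eq_divide)
    then show "z \<in> (\<Union>n. ?B n)" by (auto simp: algebra_simps intro!: exI[of _ n])
  qed (auto intro: less_le_trans)
  moreover have "incseq ?B"
    by (auto simp: incseq_def intro!: frac_le subset_ball)
  ultimately have "emeasure (density M g) (ball x r) = (SUP n. emeasure (density M g) (?B n))"
    using balls by (simp only:, intro SUP_emeasure_incseq[symmetric]) auto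
  then have "set_nn_integral M (ball x r) g = (SUP n. set_nn_integral M (?B n) g)"
    by (simp only: eq_emeasure)
  also have "\<dots> \<le> (SUP s\<in>{..<r}. set_nn_integral M (ball x s) g)"
    by (intro SUP_least SUP_upper) auto
  finally show "set_nn_integral M (ball x r) g \<le> (SUP s\<in>{..<r}. set_nn_integral M (ball x s) g)" .
  show "(SUP s\<in>{..<r}. set_nn_integral M (ball x s) g) \<le> set_nn_integral M (ball x r) g"
    by (intro SUP_least nn_integral_mono) (auto simp: indicator_def)
qed

lemma open_superlevel_maxfn:
  assumes [measurable]: "f \<in> borel_measurable lebesgue"
  shows "open {x. y < maxfn \<Phi> f x}"
proof (rule openI)
  fix x assume "x \<in> {x. y < maxfn \<Phi> f x}"
  then obtain r where r_pos: "0 < r"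
    and "y < ennreal (\<Phi> r) * set_nn_integral lebesgue (ball x r) (\<lambda>y. ennreal \<bar>f y\<bar>)"
    by (auto simp: maxfn_def less_SUP_iff)
  then obtain s where s_less_r: "s < r"
    and y_less: "y < ennreal (\<Phi> r) * set_nn_integral lebesgue (ball x s) (\<lambda>y. ennreal \<bar>f y\<bar>)"
    by (subst (asm) set_nn_integral_ball_eq_SUP) (auto simp: SUP_mult_left_ennreal less_SUP_iff)
  show "\<exists>e>0. ball x e \<subseteq> {x. y < maxfn \<Phi> f x}"
  proof (intro exI conjI subsetI)
    show "0 < r - s" using s_less_r by simp
    fix z assume "z \<in> ball x (r - s)"
    then have "ball x s \<subseteq> ball z r"
      by (simp add: ball_subset_ball_iff)
    with less_le_trans[OF y_less mult_set_nn_integral_le_maxfn[OF r_pos, of "ball x s" z \<Phi> f]]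
    show "z \<in> {x. y < maxfn \<Phi> f x}" by simp
  qed
qed

lemma borel_measurable_maxfn:
  assumes "f \<in> borel_measurable lebesgue"
  shows "maxfn \<Phi> f \<in> borel_measurable borel"
  using open_superlevel_maxfn[OF assms] by (intro borel_measurableI_greater) auto

lemma K3fun_altdef:
  assumes "0 \<le> t"
  shows "K3fun n \<Phi> f t
    = (SUP \<tau>\<in>{t<..}. ennreal (\<Phi> (root n \<tau>)) * rearr_integral (\<lambda>x. ennreal \<bar>f x\<bar>) \<tau>)"
  unfolding K3fun_def
proof (intro SUP_cong refl)
  fix \<tau> assume "\<tau> \<in> {t<..}"
  with assms have "0 < \<tau>" by simp
  then show "ennreal (\<tau> * \<Phi> (root n \<tau>)) * rearr2 (\<lambda>x. ennreal \<bar>f x\<bar>) \<tau>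
      = ennreal (\<Phi> (root n \<tau>)) * rearr_integral (\<lambda>x. ennreal \<bar>f x\<bar>) \<tau>"
    by (simp add: ennreal_mult' ac_simps flip: mult_rearr2)
qed

lemma K3fun_mono_AE:
  assumes [measurable]: "f \<in> borel_measurable lebesgue" "g \<in> borel_measurable lebesgue"
    and "AE x in lebesgue. \<bar>f x\<bar> \<le> \<bar>g x\<bar>"
  shows "K3fun n \<Phi> f t \<le> K3fun n \<Phi> g t"
  unfolding K3fun_def using assms(3)
  by (intro SUP_mono' mult_left_mono rearr2_mono_AE) (auto intro: ennreal_leI)

lemma K3fun_cmult:
  assumes [measurable]: "f \<in> borel_measurable lebesgue" and "0 \<le> a"
  shows "K3fun n \<Phi> (\<lambda>x. a * f x) t = ennreal a * K3fun n \<Phi> f t"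
proof -
  have "rearr2 (\<lambda>x. ennreal \<bar>a * f x\<bar>) s = ennreal a * rearr2 (\<lambda>x. ennreal \<bar>f x\<bar>) s" for s
    using assms(2) by (simp add: abs_mult ennreal_mult' rearr2_cmult)
  then show ?thesis
    unfolding K3fun_def SUP_mult_left_ennreal by (simp add: ac_simps)
qed

lemma mult_rearr_integral_le_K3fun:
  assumes \<Phi>_class_B: "class_B n \<Phi>" and "0 < n"
  obtains c where "0 < c"
    "\<And>(f :: 'a::euclidean_space \<Rightarrow> real) r t. 0 \<le> t \<Longrightarrow> 0 < r \<Longrightarrow> t \<le> r ^ n \<Longrightarrow>
      ennreal (\<Phi> r) * rearr_integral (\<lambda>x. ennreal \<bar>f x\<bar>) (m * r ^ n) \<le> ennreal c * K3fun n \<Phi> f t"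
proof -
  define M where "M = max m 2"
  define l where "l = root n M"
  have "1 \<le> l" using \<open>0 < n\<close> by (simp add: l_def M_def)
  obtain c where c_pos: "0 < c" and c_doubling: "\<And>r. 0 < r \<Longrightarrow> \<Phi> r \<le> c * \<Phi> (l * r)"
    using class_B_doubling[OF \<Phi>_class_B \<open>0 < n\<close> \<open>1 \<le> l\<close>] by blast
  show ?thesis
  proof
    fix f :: "'a \<Rightarrow> real" and r t :: real
    assume "0 \<le> t" and r_pos: "0 < r" and t_le_power: "t \<le> r ^ n"
    let ?I = "rearr_integral (\<lambda>x. ennreal \<bar>f x\<bar>)"
    have "r ^ n < M * r ^ n" using r_pos by (simp add: M_def)
    with t_le_power have t_less: "t < M * r ^ n" by simp
    have root_eq: "root n (M * r ^ n) = l * r"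
      using r_pos \<open>0 < n\<close> by (simp add: l_def real_root_mult real_root_power_cancel)
    have "ennreal (\<Phi> r) * ?I (m * r ^ n) \<le> ennreal (c * \<Phi> (l * r)) * ?I (M * r ^ n)"
      using r_pos
      by (intro mult_mono ennreal_leI c_doubling rearr_integral_mono mult_right_mono) (auto simp: M_def)
    also have "\<dots> = ennreal c * (ennreal (\<Phi> (root n (M * r ^ n))) * ?I (M * r ^ n))"
      using c_pos by (simp add: root_eq ennreal_mult' mult.assoc)
    also have "\<dots> \<le> ennreal c * K3fun n \<Phi> f t"
      unfolding K3fun_altdef[OF \<open>0 \<le> t\<close>] using t_less by (intro mult_left_mono SUP_upper) auto
    finally show "ennreal (\<Phi> r) * ?I (m * r ^ n) \<le> ennreal c * K3fun n \<Phi> f t" .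
  qed (rule c_pos c_doubling)
qed

lemma mult_set_nn_integral_ball_le_K3fun:
  assumes \<Phi>_class_B: "class_B DIM('a::euclidean_space) \<Phi>"
  obtains c where "0 < c"
    "\<And>(f :: 'a \<Rightarrow> real) r t x. f \<in> borel_measurable lebesgue \<Longrightarrow> 0 \<le> t \<Longrightarrow> 0 < r \<Longrightarrow> t \<le> r ^ DIM('a) \<Longrightarrow>
      ennreal (\<Phi> r) * set_nn_integral lebesgue (ball x r) (\<lambda>y. ennreal \<bar>f y\<bar>)
        \<le> ennreal c * K3fun DIM('a) \<Phi> f t"
proof -
  obtain c where c_pos: "0 < c" and c_bound: "\<And>(f :: 'a \<Rightarrow> real) r t. 0 \<le> t \<Longrightarrow> 0 < r \<Longrightarrow> t \<le> r ^ DIM('a) \<Longrightarrow>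
      ennreal (\<Phi> r) * rearr_integral (\<lambda>x. ennreal \<bar>f x\<bar>) (unit_ball_vol DIM('a) * r ^ DIM('a))
        \<le> ennreal c * K3fun DIM('a) \<Phi> f t"
    using mult_rearr_integral_le_K3fun[OF \<Phi>_class_B DIM_positive] by blast
  show ?thesis
  proof (rule that[OF c_pos])
    fix f :: "'a \<Rightarrow> real" and r t :: real and x
    assume [measurable]: "f \<in> borel_measurable lebesgue" and "0 \<le> t" "0 < r" "t \<le> r ^ DIM('a)"
    have "ennreal (\<Phi> r) * set_nn_integral lebesgue (ball x r) (\<lambda>y. ennreal \<bar>f y\<bar>)
        \<le> ennreal (\<Phi> r) * rearr_integral (\<lambda>y. ennreal \<bar>f y\<bar>) (unit_ball_vol DIM('a) * r ^ DIM('a))"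
      using \<open>0 < r\<close>
      by (intro mult_left_mono Hardy_Littlewood_set_nn_integral_le) (auto simp: emeasure_ball)
    also have "\<dots> \<le> ennreal c * K3fun DIM('a) \<Phi> f t"
      by (rule c_bound) fact+
    finally show "ennreal (\<Phi> r) * set_nn_integral lebesgue (ball x r) (\<lambda>y. ennreal \<bar>f y\<bar>)
      \<le> ennreal c * K3fun DIM('a) \<Phi> f t" .
  qed
qed

lemma maxfn_le_K3fun_add_nn_convolution:
  assumes \<Phi>_class_B: "class_B DIM('a::euclidean_space) \<Phi>"
  obtains c where "0 < c"
    "\<And>(f :: 'a \<Rightarrow> real) g (R :: real) x. f \<in> borel_measurable lebesgue \<Longrightarrow> g \<in> borel_measurable borel \<Longrightarrow>
      AE x in lebesgue. ennreal \<bar>f x\<bar> = g x \<Longrightarrow> 0 < R \<Longrightarrow>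
      maxfn \<Phi> f x \<le> ennreal c * K3fun DIM('a) \<Phi> f (R ^ DIM('a)) + nn_convolution (radial_kernel \<Phi> R) g x"
proof -
  obtain c where c_pos: "0 < c" and c_bound: "\<And>(f :: 'a \<Rightarrow> real) r t x.
      f \<in> borel_measurable lebesgue \<Longrightarrow> 0 \<le> t \<Longrightarrow> 0 < r \<Longrightarrow> t \<le> r ^ DIM('a) \<Longrightarrow>
      ennreal (\<Phi> r) * set_nn_integral lebesgue (ball x r) (\<lambda>y. ennreal \<bar>f y\<bar>)
        \<le> ennreal c * K3fun DIM('a) \<Phi> f t"
    using mult_set_nn_integral_ball_le_K3fun[OF \<Phi>_class_B] by blast
  show ?thesis
  proof (rule that[OF c_pos])
    fix f :: "'a \<Rightarrow> real" and g x and R :: real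
    assume f_measurable: "f \<in> borel_measurable lebesgue" and g_measurable: "g \<in> borel_measurable borel"
      and abs_f_eq_g: "AE x in lebesgue. ennreal \<bar>f x\<bar> = g x" and R_pos: "0 < R"
    show "maxfn \<Phi> f x
        \<le> ennreal c * K3fun DIM('a) \<Phi> f (R ^ DIM('a)) + nn_convolution (radial_kernel \<Phi> R) g x"
      unfolding maxfn_def
    proof (rule SUP_least)
      fix r :: real assume "r \<in> {0<..}"
      then have r_pos: "0 < r" by simp
      let ?average = "ennreal (\<Phi> r) * set_nn_integral lebesgue (ball x r) (\<lambda>y. ennreal \<bar>f y\<bar>)"
      have "?average \<le> ennreal c * K3fun DIM('a) \<Phi> f (R ^ DIM('a))" if "R \<le> r"
        using that R_pos r_pos by (intro c_bound f_measurable power_mono) auto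
      moreover have "?average \<le> nn_convolution (radial_kernel \<Phi> R) g x" if "r \<le> R"
      proof -
        have "?average = ennreal (\<Phi> r) * set_nn_integral lebesgue (ball x r) g"
          using abs_f_eq_g by (intro arg_cong2[where f = "(*)"] refl nn_integral_cong_AE) auto
        also have "\<dots> = ennreal (\<Phi> r) * set_nn_integral lborel (ball x r) g"
          by (simp add: nn_integral_completion)
        also have "\<dots> \<le> nn_convolution (radial_kernel \<Phi> R) g x"
          by (rule mult_set_nn_integral_ball_le_nn_convolution[OF \<Phi>_class_B r_pos that g_measurable])
        finally show ?thesis .
      qed
      ultimately show "?average
          \<le> ennreal c * K3fun DIM('a) \<Phi> f (R ^ DIM('a)) + nn_convolution (radial_kernel \<Phi> R) g x"
        by (cases "R \<le> r") (auto intro: add_increasing add_increasing2)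
    qed
  qed
qed

lemma rearr_integral_nn_convolution_radial_kernel_le_K3fun:
  assumes \<Phi>_class_B: "class_B DIM('a::euclidean_space) \<Phi>"
  obtains c where "0 < c"
    "\<And>(f :: 'a \<Rightarrow> real) g (R :: real). f \<in> borel_measurable lebesgue \<Longrightarrow> g \<in> borel_measurable borel \<Longrightarrow>
      AE x in lebesgue. ennreal \<bar>f x\<bar> = g x \<Longrightarrow> 0 < R \<Longrightarrow>
      rearr_integral (nn_convolution (radial_kernel \<Phi> R) g) (R ^ DIM('a))
        \<le> ennreal (R ^ DIM('a)) * (ennreal c * K3fun DIM('a) \<Phi> f (R ^ DIM('a)))"
proof -
  obtain D where D_pos: "0 < D" and D_bound: "\<And>R. 0 < R \<Longrightarrow>
      (\<integral>\<^sup>+z. radial_kernel \<Phi> R (z::'a) \<partial>lborel) \<le> ennreal (D * \<Phi> R * R ^ DIM('a))"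
    using nn_integral_radial_kernel_le[OF \<Phi>_class_B] by blast
  obtain b where b_pos: "0 < b"
    and b_bound: "\<And>(f :: 'a \<Rightarrow> real) r t. 0 \<le> t \<Longrightarrow> 0 < r \<Longrightarrow> t \<le> r ^ DIM('a) \<Longrightarrow>
      ennreal (\<Phi> r) * rearr_integral (\<lambda>x. ennreal \<bar>f x\<bar>) (1 * r ^ DIM('a))
        \<le> ennreal b * K3fun DIM('a) \<Phi> f t"
    using mult_rearr_integral_le_K3fun[OF \<Phi>_class_B DIM_positive] by blast
  show ?thesis
  proof
    show "0 < D * b" using D_pos b_pos by simp
    fix f :: "'a \<Rightarrow> real" and g and R :: real
    assume [measurable]: "f \<in> borel_measurable lebesgue" "g \<in> borel_measurable borel"
      and abs_f_eq_g: "AE x in lebesgue. ennreal \<bar>f x\<bar> = g x" and R_pos: "0 < R"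
    let ?t = "R ^ DIM('a)" and ?I = "rearr_integral (\<lambda>x. ennreal \<bar>f x\<bar>)"
    have "rearr_integral (nn_convolution (radial_kernel \<Phi> R) g) ?t
        \<le> (\<integral>\<^sup>+z. radial_kernel \<Phi> R (z::'a) \<partial>lborel) * rearr_integral g ?t"
      using R_pos
      by (intro rearr_integral_nn_convolution_le borel_measurable_radial_kernel[OF \<Phi>_class_B]) auto
    also have "\<dots> \<le> ennreal (D * \<Phi> R * ?t) * rearr_integral g ?t"
      by (intro mult_right_mono D_bound R_pos) simp
    also have "rearr_integral g ?t = ?I ?t"
      unfolding rearr_integral_def using abs_f_eq_g
      by (subst rearr_cong_AE[of g]) (auto intro: borel_measurable_lebesgueI)
    also have "ennreal (D * \<Phi> R * ?t) * ?I ?t = ennreal ?t * (ennreal D * (ennreal (\<Phi> R) * ?I ?t))"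
      using D_pos class_B_pos[OF \<Phi>_class_B R_pos] R_pos by (simp add: ennreal_mult ac_simps)
    also have "\<dots> \<le> ennreal ?t * (ennreal D * (ennreal b * K3fun DIM('a) \<Phi> f ?t))"
      using b_bound[of ?t R f] R_pos by (intro mult_left_mono) auto
    also have "\<dots> = ennreal ?t * (ennreal (D * b) * K3fun DIM('a) \<Phi> f ?t)"
      using D_pos by (simp add: ennreal_mult' mult.assoc)
    finally show "rearr_integral (nn_convolution (radial_kernel \<Phi> R) g) ?t
      \<le> ennreal ?t * (ennreal (D * b) * K3fun DIM('a) \<Phi> f ?t)" .
  qed
qed

lemma rearr2_maxfn_le_K3fun:
  assumes \<Phi>_class_B: "class_B DIM('a::euclidean_space) \<Phi>"
  obtains C where "0 < C"
    "\<And>(f::'a \<Rightarrow> real) t. f \<in> borel_measurable lebesgue \<Longrightarrow> 0 < t \<Longrightarrow>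
      rearr2 (maxfn \<Phi> f) t \<le> ennreal C * K3fun DIM('a) \<Phi> f t"
proof -
  obtain b where b_pos: "0 < b" and b_bound: "\<And>(f :: 'a \<Rightarrow> real) g R. f \<in> borel_measurable lebesgue \<Longrightarrow>
      g \<in> borel_measurable borel \<Longrightarrow> AE x in lebesgue. ennreal \<bar>f x\<bar> = g x \<Longrightarrow> 0 < R \<Longrightarrow>
      rearr_integral (nn_convolution (radial_kernel \<Phi> R) g) (R ^ DIM('a))
        \<le> ennreal (R ^ DIM('a)) * (ennreal b * K3fun DIM('a) \<Phi> f (R ^ DIM('a)))"
    using rearr_integral_nn_convolution_radial_kernel_le_K3fun[OF \<Phi>_class_B] by blast
  obtain c where c_pos: "0 < c" and c_bound: "\<And>(f :: 'a \<Rightarrow> real) g R x. f \<in> borel_measurable lebesgue \<Longrightarrow>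
      g \<in> borel_measurable borel \<Longrightarrow> AE x in lebesgue. ennreal \<bar>f x\<bar> = g x \<Longrightarrow> 0 < R \<Longrightarrow>
      maxfn \<Phi> f x \<le> ennreal c * K3fun DIM('a) \<Phi> f (R ^ DIM('a)) + nn_convolution (radial_kernel \<Phi> R) g x"
    using maxfn_le_K3fun_add_nn_convolution[OF \<Phi>_class_B] by blast
  show ?thesis
  proof
    show "0 < c + b" using b_pos c_pos by simp
    fix f :: "'a \<Rightarrow> real" and t :: real
    assume f_measurable [measurable]: "f \<in> borel_measurable lebesgue" and t_pos: "0 < t"
    define S where "S = K3fun DIM('a) \<Phi> f t"
    define R where "R = root DIM('a) t"
    have R_pos: "0 < R" and R_power: "R ^ DIM('a) = t" using t_pos by (simp_all add: R_def)
    obtain g where "g \<in> borel_measurable lborel" "AE x in lborel. ennreal \<bar>f x\<bar> = g x"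
      using completion_ex_borel_measurable[of "\<lambda>x. ennreal \<bar>f x\<bar>" lborel] by auto
    then have g_measurable [measurable]: "g \<in> borel_measurable borel"
      and abs_f_eq_g: "AE x in lebesgue. ennreal \<bar>f x\<bar> = g x"
      by (auto simp: AE_completion)
    let ?v = "nn_convolution (radial_kernel \<Phi> R) g"
    note [measurable] = borel_measurable_radial_kernel[OF \<Phi>_class_B, of R]
    have "rearr_integral (maxfn \<Phi> f) t \<le> rearr_integral (\<lambda>x. ennreal c * S + ?v x) t"
      using c_bound[OF f_measurable g_measurable abs_f_eq_g R_pos]
        borel_measurable_maxfn[OF f_measurable]
      by (intro rearr_integral_mono_AE AE_I2 borel_measurable_lebesgueI) (auto simp: S_def R_power)
    also have "\<dots> \<le> ennreal t * (ennreal c * S) + rearr_integral ?v t"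
      using t_pos by (intro rearr_integral_const_add_le borel_measurable_lebesgueI) auto
    also have "\<dots> \<le> ennreal t * (ennreal c * S) + ennreal t * (ennreal b * S)"
      using b_bound[OF f_measurable g_measurable abs_f_eq_g R_pos]
      by (intro add_left_mono) (simp add: S_def R_power)
    also have "\<dots> = ennreal t * (ennreal (c + b) * S)"
      using b_pos c_pos by (simp add: algebra_simps)
    finally show "rearr2 (maxfn \<Phi> f) t \<le> ennreal (c + b) * K3fun DIM('a) \<Phi> f t"
      unfolding S_def by (rule rearr2_leI) fact
  qed
qed

lemma mult_set_nn_integral_ball_le_rearr_maxfn:
  fixes f :: "'a::euclidean_space \<Rightarrow> real"
  assumes "f \<in> borel_measurable lebesgue" and "0 < r" "ennreal t < emeasure lborel (ball z r)"
  shows "ennreal (\<Phi> (2 * r)) * set_nn_integral lebesgue (ball z r) (\<lambda>x. ennreal \<bar>f x\<bar>)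
    \<le> rearr (maxfn \<Phi> f) t"
proof (rule le_rearrI)
  show "maxfn \<Phi> f \<in> borel_measurable lebesgue"
    by (intro borel_measurable_lebesgueI borel_measurable_maxfn assms)
  show "ennreal t < emeasure lebesgue (ball z r)" using assms(3) by simp
  fix x assume "x \<in> ball z r"
  then have "ball z r \<subseteq> ball x (2 * r)"
    by (simp add: ball_subset_ball_iff)
  then show "ennreal (\<Phi> (2 * r)) * set_nn_integral lebesgue (ball z r) (\<lambda>x. ennreal \<bar>f x\<bar>) \<le> maxfn \<Phi> f x"
    using \<open>0 < r\<close> by (intro mult_set_nn_integral_le_maxfn) auto
qed

lemma K3fun_le_rearr_maxfn:
  assumes \<Phi>_class_B: "class_B DIM('a::euclidean_space) \<Phi>"
  obtains c where "0 < c"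
    "\<And>(f :: 'a \<Rightarrow> real) h t. f \<in> borel_measurable lebesgue \<Longrightarrow> h \<in> borel_measurable lebesgue \<Longrightarrow>
      AE x in lebesgue. ennreal \<bar>h x\<bar> = radial_rearr (\<lambda>x. ennreal \<bar>f x\<bar>) x \<Longrightarrow> 0 \<le> t \<Longrightarrow>
      K3fun DIM('a) \<Phi> f t \<le> ennreal c * rearr (maxfn \<Phi> h) t"
proof -
  obtain c where c_pos: "0 < c"
    and c_bound: "\<And>r. 0 < r \<Longrightarrow> \<Phi> (root DIM('a) (ball_vol DIM('a) r)) \<le> c * \<Phi> (2 * r)"
    using class_B_root_ball_vol_le[OF \<Phi>_class_B DIM_positive, of 2] by auto
  show ?thesis
  proof (rule that[OF c_pos])
    fix f h :: "'a \<Rightarrow> real" and t :: real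
    assume [measurable]: "f \<in> borel_measurable lebesgue" and h_measurable: "h \<in> borel_measurable lebesgue"
      and radial: "AE x in lebesgue. ennreal \<bar>h x\<bar> = radial_rearr (\<lambda>x. ennreal \<bar>f x\<bar>) x"
      and t_nonneg: "0 \<le> t"
    show "K3fun DIM('a) \<Phi> f t \<le> ennreal c * rearr (maxfn \<Phi> h) t"
      unfolding K3fun_altdef[OF t_nonneg]
    proof (rule SUP_least)
      fix \<tau> assume "\<tau> \<in> {t<..}"
      with t_nonneg have t_less: "t < \<tau>" and \<tau>_pos: "0 < \<tau>" by auto
      obtain r where "0 \<le> r" and ball_vol_r: "ball_vol DIM('a) r = \<tau>"
        using ball_vol_eqE[of "DIM('a)" \<tau>] \<tau>_pos by auto
      with \<tau>_pos have r_pos: "0 < r" by (cases "r = 0") (auto simp: ball_vol_def zero_power)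
      let ?J = "set_nn_integral lebesgue (ball 0 r) (\<lambda>x. ennreal \<bar>h x\<bar>)"
      have "rearr_integral (\<lambda>x. ennreal \<bar>f x\<bar>) \<tau>
          = set_nn_integral lebesgue (ball 0 r) (radial_rearr (\<lambda>x. ennreal \<bar>f x\<bar>))"
        using \<open>0 \<le> r\<close> by (subst set_nn_integral_ball_radial_rearr) (simp_all add: ball_vol_r)
      also have "\<dots> = ?J"
        using radial by (intro nn_integral_cong_AE) (auto elim: eventually_mono)
      finally have "ennreal (\<Phi> (root DIM('a) \<tau>)) * rearr_integral (\<lambda>x. ennreal \<bar>f x\<bar>) \<tau>
          \<le> ennreal (c * \<Phi> (2 * r)) * ?J"
        using c_bound[OF r_pos] by (intro mult_mono ennreal_leI) (auto simp: ball_vol_r)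
      also have "\<dots> \<le> ennreal c * rearr (maxfn \<Phi> h) t"
        using c_pos r_pos ball_vol_r t_less t_nonneg
          mult_set_nn_integral_ball_le_rearr_maxfn[OF h_measurable r_pos, of t 0 \<Phi>]
        by (simp add: ennreal_mult' mult.assoc mult_left_mono emeasure_ball ennreal_less_iff
            flip: ball_vol_def)
      finally show "ennreal (\<Phi> (root DIM('a) \<tau>)) * rearr_integral (\<lambda>x. ennreal \<bar>f x\<bar>) \<tau>
        \<le> ennreal c * rearr (maxfn \<Phi> h) t" .
    qed
  qed
qed

lemma K3fun_le_max:
  assumes \<Phi>_class_B: "class_B n \<Phi>" and "0 < n" "0 < t" "0 \<le> s"
  shows "K3fun n \<Phi> f t
    \<le> max (ennreal (\<Phi> (root n t)) * rearr_integral (\<lambda>x. ennreal \<bar>f x\<bar>) s) (K3fun n \<Phi> f s)"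
    (is "_ \<le> max ?local _")
  unfolding K3fun_altdef[OF less_imp_le[OF \<open>0 < t\<close>]]
proof (rule SUP_least)
  fix \<tau> assume "\<tau> \<in> {t<..}"
  then have t_less: "t < \<tau>" by simp
  let ?term = "ennreal (\<Phi> (root n \<tau>)) * rearr_integral (\<lambda>x. ennreal \<bar>f x\<bar>) \<tau>"
  show "?term \<le> max ?local (K3fun n \<Phi> f s)"
  proof (cases "\<tau> \<le> s")
    case True
    have "?term \<le> ?local"
      using assms t_less True
      by (intro mult_mono ennreal_leI rearr_integral_mono class_B_antimono[OF \<Phi>_class_B]) auto
    then show ?thesis by (simp add: le_max_iff_disj)
  next
    case False
    then have "?term \<le> K3fun n \<Phi> f s"
      unfolding K3fun_altdef[OF \<open>0 \<le> s\<close>] by (intro SUP_upper) auto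
    then show ?thesis by (simp add: le_max_iff_disj)
  qed
qed

section \<open>Banach function norms\<close>

type_synonym 'a function_norm = "('a \<Rightarrow> ennreal) \<Rightarrow> ennreal"

lemma
  fixes \<rho> :: "'a::euclidean_space function_norm"
  assumes "banach_function_norm \<rho>"
  shows bfn_cmult: "f \<in> borel_measurable lebesgue \<Longrightarrow> 0 \<le> a \<Longrightarrow> \<rho> (\<lambda>x. ennreal a * f x) = ennreal a * \<rho> f"
    and bfn_add: "f \<in> borel_measurable lebesgue \<Longrightarrow> g \<in> borel_measurable lebesgue \<Longrightarrow>
      \<rho> (\<lambda>x. f x + g x) \<le> \<rho> f + \<rho> g"
    and bfn_mono_AE: "f \<in> borel_measurable lebesgue \<Longrightarrow> g \<in> borel_measurable lebesgue \<Longrightarrow>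
      AE x in lebesgue. f x \<le> g x \<Longrightarrow> \<rho> f \<le> \<rho> g"
    and bfn_SUP: "(\<And>k::nat. fs k \<in> borel_measurable lebesgue) \<Longrightarrow> f \<in> borel_measurable lebesgue \<Longrightarrow>
      AE x in lebesgue. incseq (\<lambda>k. fs k x) \<and> (SUP k. fs k x) = f x \<Longrightarrow> \<rho> f = (SUP k. \<rho> (fs k))"
    and bfn_set_nn_integral_le: "A \<in> sets lebesgue \<Longrightarrow> emeasure lebesgue A < \<infinity> \<Longrightarrow>
      \<exists>C::real. \<forall>f \<in> borel_measurable lebesgue. set_nn_integral lebesgue A f \<le> ennreal C * \<rho> f"
  using assms unfolding banach_function_norm_def by blast+

lemma bfn_cong_AE:
  assumes "banach_function_norm \<rho>" "f \<in> borel_measurable lebesgue" "g \<in> borel_measurable lebesgue"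
    and "AE x in lebesgue. f x = g x"
  shows "\<rho> f = \<rho> g"
  using assms by (intro order_antisym bfn_mono_AE) auto

lemma ri_norm_bfn: "ri_norm \<rho> \<Longrightarrow> banach_function_norm \<rho>"
  and ri_norm_mono: "ri_norm \<rho> \<Longrightarrow> f \<in> borel_measurable lebesgue \<Longrightarrow> g \<in> borel_measurable lebesgue \<Longrightarrow>
    (\<And>t. 0 < t \<Longrightarrow> rearr f t \<le> rearr g t) \<Longrightarrow> \<rho> f \<le> \<rho> g"
  unfolding ri_norm_def by blast+

lemma ri_norm_radial_rearr:
  assumes "ri_norm \<rho>" "g \<in> borel_measurable lebesgue"
  shows "\<rho> (radial_rearr g) = \<rho> g"
proof -
  note radial = borel_measurable_lebesgueI[OF borel_measurable_radial_rearr[OF assms(2)]]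
  show ?thesis
    using ri_norm_mono[OF assms(1) radial assms(2)] ri_norm_mono[OF assms(1,2) radial]
    by (simp add: rearr_radial_rearr[OF assms(2)] order_antisym)
qed

lemma bfn_set_nn_integral_finite:
  assumes "banach_function_norm \<rho>" "f \<in> borel_measurable lebesgue" "\<rho> f < \<infinity>"
    and "A \<in> sets lebesgue" "emeasure lebesgue A < \<infinity>"
  shows "set_nn_integral lebesgue A f < \<infinity>"
proof -
  obtain C where "set_nn_integral lebesgue A f \<le> ennreal C * \<rho> f"
    using bfn_set_nn_integral_le[OF assms(1,4,5)] assms(2) by blast
  also have "\<dots> < \<infinity>" using assms(3) by (simp add: ennreal_mult_less_top)
  finally show ?thesis .
qed

lemma bfn_AE_finite:
  fixes \<rho> :: "'a::euclidean_space function_norm"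
  assumes bfn: "banach_function_norm \<rho>" and [measurable]: "g \<in> borel_measurable lebesgue"
    and "\<rho> g < \<infinity>"
  shows "AE x in lebesgue. g x < \<infinity>"
proof -
  have "AE x in lebesgue. \<forall>n::nat. x \<in> ball 0 (real n) \<longrightarrow> g x < \<infinity>"
    unfolding AE_all_countable
  proof
    fix n :: nat
    let ?B = "ball (0::'a) (real n)"
    have [measurable]: "?B \<in> sets lebesgue" by simp
    have "set_nn_integral lebesgue ?B g < \<infinity>"
      using assms by (intro bfn_set_nn_integral_finite[OF bfn]) (auto simp: emeasure_ball)
    then have "AE x in lebesgue. g x * indicator ?B x \<noteq> \<infinity>"
      by (intro nn_integral_PInf_AE) auto
    then show "AE x in lebesgue. x \<in> ?B \<longrightarrow> g x < \<infinity>"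
      by eventually_elim (auto simp: indicator_def less_top)
  qed
  then show ?thesis
  proof eventually_elim
    case (elim x)
    obtain n :: nat where "norm x < real n" using reals_Archimedean2 by blast
    with elim show ?case by auto
  qed
qed

lemma bfn_suminf_le:
  assumes bfn: "banach_function_norm \<rho>" and [measurable]: "\<And>k::nat. fs k \<in> borel_measurable lebesgue"
  shows "\<rho> (\<lambda>x. \<Sum>k. fs k x) \<le> (\<Sum>k. \<rho> (fs k))"
proof -
  have partial: "\<rho> (\<lambda>x. \<Sum>k<n. fs k x) \<le> (\<Sum>k<n. \<rho> (fs k))" for n
  proof (induction n)
    case 0
    show ?case using bfn_cmult[OF bfn, of "\<lambda>_. 0" 0] by simp
  next
    case (Suc n)
    have "\<rho> (\<lambda>x. (\<Sum>k<n. fs k x) + fs n x) \<le> \<rho> (\<lambda>x. \<Sum>k<n. fs k x) + \<rho> (fs n)"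
      by (rule bfn_add[OF bfn]) measurable
    with Suc show ?case by (auto intro: order_trans add_right_mono)
  qed
  have "\<rho> (\<lambda>x. \<Sum>k. fs k x) = (SUP n. \<rho> (\<lambda>x. \<Sum>k<n. fs k x))"
    by (rule bfn_SUP[OF bfn]) (auto simp: suminf_eq_SUP incseq_def intro!: sum_mono2)
  also have "\<dots> \<le> (\<Sum>k. \<rho> (fs k))"
    by (intro SUP_least order_trans[OF partial] sum_le_suminf) auto
  finally show ?thesis .
qed

lemma rearr_integral_finite:
  fixes \<rho> :: "'a::euclidean_space function_norm"
  assumes ri: "ri_norm \<rho>" and g_measurable: "g \<in> borel_measurable lebesgue" and "\<rho> g < \<infinity>"
  shows "rearr_integral g t < \<infinity>"
proof (cases "0 \<le> t")
  case True
  then obtain r where r_nonneg: "0 \<le> r" and ball_vol_r: "ball_vol DIM('a) r = t"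
    using ball_vol_eqE[of "DIM('a)" t] by auto
  have "set_nn_integral lebesgue (ball 0 r) (radial_rearr g) < \<infinity>"
    using borel_measurable_lebesgueI[OF borel_measurable_radial_rearr[OF g_measurable]]
      ri_norm_radial_rearr[OF ri g_measurable] assms(3) r_nonneg
    by (intro bfn_set_nn_integral_finite[OF ri_norm_bfn[OF ri]]) (auto simp: emeasure_ball)
  with r_nonneg ball_vol_r show ?thesis
    by (simp add: set_nn_integral_ball_radial_rearr[OF g_measurable])
next
  case False
  then show ?thesis by (simp add: rearr_integral_def)
qed

lemma
  assumes "f \<in> Espace \<rho>"
  shows Espace_measurable: "f \<in> borel_measurable lebesgue"
    and Espace_norm_finite: "Enorm \<rho> f < \<infinity>"
  using assms by (auto simp: Espace_def Enorm_def)

lemma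
  assumes "banach_function_norm \<rho>" "f \<in> Espace \<rho>" "0 \<le> a"
  shows Espace_cmult: "(\<lambda>x. a * f x) \<in> Espace \<rho>"
    and Enorm_cmult: "Enorm \<rho> (\<lambda>x. a * f x) = ennreal a * Enorm \<rho> f"
proof -
  have [measurable]: "f \<in> borel_measurable lebesgue" using assms(2) by (rule Espace_measurable)
  show "Enorm \<rho> (\<lambda>x. a * f x) = ennreal a * Enorm \<rho> f"
    unfolding Enorm_def using assms(3)
    by (simp add: abs_mult ennreal_mult' bfn_cmult[OF assms(1)])
  then show "(\<lambda>x. a * f x) \<in> Espace \<rho>"
    using assms(2) by (auto simp: Espace_def Enorm_def ennreal_mult_less_top)
qed

lemma Espace_locally_integrable:
  fixes \<rho> :: "'a::euclidean_space function_norm"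
  assumes bfn: "banach_function_norm \<rho>" and f_Espace: "f \<in> Espace \<rho>"
  shows "locally_integrable f"
  unfolding locally_integrable_def
proof (intro allI impI)
  fix K :: "'a set" assume K_compact: "compact K"
  then have [measurable]: "K \<in> sets lebesgue" by (simp add: compact_imp_closed borel_closed)
  have [measurable]: "f \<in> borel_measurable lebesgue" using f_Espace by (rule Espace_measurable)
  have "set_nn_integral lebesgue K (\<lambda>x. ennreal \<bar>f x\<bar>) < \<infinity>"
    using Espace_norm_finite[OF f_Espace] emeasure_compact_finite[OF K_compact] K_compact
    by (intro bfn_set_nn_integral_finite[OF bfn]) (auto simp: Enorm_def compact_imp_closed borel_closed)
  then have "(\<integral>\<^sup>+x. ennreal (norm (indicator K x *\<^sub>R f x)) \<partial>lebesgue) < \<infinity>"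
    by (rule le_less_trans[rotated]) (auto intro!: nn_integral_mono simp: indicator_def)
  then show "set_integrable lebesgue K f"
    unfolding set_integrable_def by (intro integrableI_bounded) measurable
qed

lemma Espace_representativeE:
  fixes \<rho> :: "'a::euclidean_space function_norm"
  assumes bfn: "banach_function_norm \<rho>" and [measurable]: "g \<in> borel_measurable lebesgue"
    and "\<rho> g < \<infinity>"
  obtains f where "f \<in> Espace \<rho>" "AE x in lebesgue. ennreal \<bar>f x\<bar> = g x" "Enorm \<rho> f = \<rho> g"
proof
  show abs_eq: "AE x in lebesgue. ennreal \<bar>enn2real (g x)\<bar> = g x"
    using bfn_AE_finite[OF assms] by eventually_elim simp
  show "Enorm \<rho> (\<lambda>x. enn2real (g x)) = \<rho> g"
    unfolding Enorm_def using abs_eq by (intro bfn_cong_AE[OF bfn]) auto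
  then show "(\<lambda>x. enn2real (g x)) \<in> Espace \<rho>"
    using assms(3) by (auto simp: Espace_def Enorm_def)
qed

lemma Espace_dominating_sequence:
  fixes \<rho> :: "'a::euclidean_space function_norm"
  assumes bfn: "banach_function_norm \<rho>" and fs_Espace: "\<And>k::nat. fs k \<in> Espace \<rho>"
    and summable: "(\<Sum>k. Enorm \<rho> (fs k)) < \<infinity>"
  obtains f where "f \<in> Espace \<rho>" "\<And>k. AE x in lebesgue. \<bar>fs k x\<bar> \<le> \<bar>f x\<bar>"
proof -
  have [measurable]: "fs k \<in> borel_measurable lebesgue" for k using fs_Espace by (rule Espace_measurable)
  define g where "g x = (\<Sum>k. ennreal \<bar>fs k x\<bar>)" for x
  have [measurable]: "g \<in> borel_measurable lebesgue" unfolding g_def by measurable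
  have "\<rho> g \<le> (\<Sum>k. Enorm \<rho> (fs k))"
    unfolding g_def Enorm_def by (rule bfn_suminf_le[OF bfn]) measurable
  with summable have "\<rho> g < \<infinity>" by simp
  then obtain f where f_Espace: "f \<in> Espace \<rho>" and abs_f_eq_g: "AE x in lebesgue. ennreal \<bar>f x\<bar> = g x"
    by (rule Espace_representativeE[OF bfn, rotated]) measurable
  have "\<bar>fs k x\<bar> \<le> \<bar>f x\<bar>" if "ennreal \<bar>f x\<bar> = g x" for k x
  proof -
    have "(\<Sum>j\<in>{k}. ennreal \<bar>fs j x\<bar>) \<le> g x"
      unfolding g_def by (rule sum_le_suminf) auto
    with that[symmetric] show ?thesis by simp
  qed
  with abs_f_eq_g have "AE x in lebesgue. \<bar>fs k x\<bar> \<le> \<bar>f x\<bar>" for k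
    by (rule eventually_mono)
  with f_Espace show ?thesis by (rule that)
qed

section \<open>Coverings of cones\<close>

lemma covered_by_trans:
  assumes "covered_by K \<rho>K L \<rho>L" "covered_by L \<rho>L M \<rho>M"
  shows "covered_by K \<rho>K M \<rho>M"
proof -
  obtain C where C_pos: "C > 0"
    and L_covers: "\<And>h. h \<in> K \<Longrightarrow> \<exists>k\<in>L. \<rho>L k \<le> ennreal C * \<rho>K h \<and> (\<forall>t>0. h t \<le> k t)"
    using assms(1) unfolding covered_by_def by blast
  obtain D where D_pos: "D > 0"
    and M_covers: "\<And>k. k \<in> L \<Longrightarrow> \<exists>m\<in>M. \<rho>M m \<le> ennreal D * \<rho>L k \<and> (\<forall>t>0. k t \<le> m t)"
    using assms(2) unfolding covered_by_def by blast
  show ?thesis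
    unfolding covered_by_def
  proof (intro exI[of _ "D * C"] conjI ballI)
    show "0 < D * C" using C_pos D_pos by simp
    fix h assume "h \<in> K"
    from L_covers[OF this] obtain k where "k \<in> L" and gauge_k: "\<rho>L k \<le> ennreal C * \<rho>K h"
      and h_le_k: "\<And>t. t > 0 \<Longrightarrow> h t \<le> k t" by blast
    from M_covers[OF \<open>k \<in> L\<close>] obtain m where "m \<in> M" and gauge_m: "\<rho>M m \<le> ennreal D * \<rho>L k"
      and k_le_m: "\<And>t. t > 0 \<Longrightarrow> k t \<le> m t" by blast
    have "\<rho>M m \<le> ennreal D * (ennreal C * \<rho>K h)"
      using gauge_m mult_left_mono[OF gauge_k, of "ennreal D"] by (auto intro: order_trans)
    also have "\<dots> = ennreal (D * C) * \<rho>K h"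
      using D_pos by (simp add: ennreal_mult' mult.assoc)
    finally show "\<exists>m\<in>M. \<rho>M m \<le> ennreal (D * C) * \<rho>K h \<and> (\<forall>t>0. h t \<le> m t)"
      using \<open>m \<in> M\<close> h_le_k k_le_m by (auto intro: order_trans)
  qed
qed

lemma cone_equiv_sym: "cone_equiv K \<rho>K L \<rho>L \<Longrightarrow> cone_equiv L \<rho>L K \<rho>K"
  by (simp add: cone_equiv_def)

lemma cone_equiv_trans: "cone_equiv K \<rho>K L \<rho>L \<Longrightarrow> cone_equiv L \<rho>L M \<rho>M \<Longrightarrow> cone_equiv K \<rho>K M \<rho>M"
  unfolding cone_equiv_def by (blast intro: covered_by_trans)

type_synonym 'a cone_operator = "('a \<Rightarrow> real) \<Rightarrow> real \<Rightarrow> ennreal"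

definition cone_fibre :: "'a::euclidean_space function_norm \<Rightarrow> 'a cone_operator
    \<Rightarrow> (real \<Rightarrow> ennreal) \<Rightarrow> ('a \<Rightarrow> real) set" where
  "cone_fibre \<rho> T h = {f \<in> Espace \<rho>. \<forall>t>0. T f t = h t}"

definition cone :: "'a::euclidean_space function_norm \<Rightarrow> 'a cone_operator \<Rightarrow> (real \<Rightarrow> ennreal) set" where
  "cone \<rho> T = {h. cone_fibre \<rho> T h \<noteq> {}}"

definition cone_gauge :: "'a::euclidean_space function_norm \<Rightarrow> 'a cone_operator
    \<Rightarrow> (real \<Rightarrow> ennreal) \<Rightarrow> ennreal" where
  "cone_gauge \<rho> T h = (INF f\<in>cone_fibre \<rho> T h. Enorm \<rho> f)"

lemma in_cone_iff: "h \<in> cone \<rho> T \<longleftrightarrow> (\<exists>f\<in>Espace \<rho>. \<forall>t>0. h t = T f t)"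
  unfolding cone_def cone_fibre_def by (simp add: ex_in_conv[symmetric] Bex_def eq_commute[of "h _"])

lemma K3_eq_cone: "K3 n \<rho> \<Phi> = cone \<rho> (K3fun n \<Phi>)"
  and rhoK3_eq_cone_gauge: "rhoK3 n \<rho> \<Phi> = cone_gauge \<rho> (K3fun n \<Phi>)"
  by (auto simp: K3_def in_cone_iff rhoK3_def cone_gauge_def cone_fibre_def)

lemma MEspace_eq_image: "banach_function_norm \<rho> \<Longrightarrow> MEspace \<rho> \<Phi> = maxfn \<Phi> ` Espace \<rho>"
  using Espace_locally_integrable[of \<rho>] by (auto simp: MEspace_def)

lemma INF_MEnorm_eq_INF_Enorm:
  assumes "banach_function_norm \<rho>"
  shows "(INF u\<in>{u \<in> MEspace \<rho> \<Phi>. P u}. MEnorm \<rho> \<Phi> u)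
    = (INF f\<in>{f \<in> Espace \<rho>. P (maxfn \<Phi> f)}. Enorm \<rho> f)"
    (is "?M = ?E")
proof (rule antisym)
  show "?M \<le> ?E"
  proof (rule INF_greatest)
    fix f assume f_admissible: "f \<in> {f \<in> Espace \<rho>. P (maxfn \<Phi> f)}"
    have "?M \<le> MEnorm \<rho> \<Phi> (maxfn \<Phi> f)"
      using f_admissible by (intro INF_lower) (auto simp: MEspace_eq_image[OF assms])
    also have "\<dots> \<le> Enorm \<rho> f"
      unfolding MEnorm_def using f_admissible Espace_locally_integrable[OF assms]
      by (intro INF_lower) auto
    finally show "?M \<le> Enorm \<rho> f" .
  qed
  show "?E \<le> ?M"
    unfolding MEnorm_def by (intro INF_greatest INF_lower) auto
qed

lemma
  assumes "banach_function_norm \<rho>"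
  shows K1_eq_cone: "K1 \<rho> \<Phi> = cone \<rho> (\<lambda>f. rearr (maxfn \<Phi> f))"
    and K2_eq_cone: "K2 \<rho> \<Phi> = cone \<rho> (\<lambda>f. rearr2 (maxfn \<Phi> f))"
    and rhoK1_eq_cone_gauge: "rhoK1 \<rho> \<Phi> = cone_gauge \<rho> (\<lambda>f. rearr (maxfn \<Phi> f))"
    and rhoK2_eq_cone_gauge: "rhoK2 \<rho> \<Phi> = cone_gauge \<rho> (\<lambda>f. rearr2 (maxfn \<Phi> f))"
proof -
  show "K1 \<rho> \<Phi> = cone \<rho> (\<lambda>f. rearr (maxfn \<Phi> f))" "K2 \<rho> \<Phi> = cone \<rho> (\<lambda>f. rearr2 (maxfn \<Phi> f))"
    by (auto simp: K1_def K2_def in_cone_iff MEspace_eq_image[OF assms])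
  show "rhoK1 \<rho> \<Phi> = cone_gauge \<rho> (\<lambda>f. rearr (maxfn \<Phi> f))"
    "rhoK2 \<rho> \<Phi> = cone_gauge \<rho> (\<lambda>f. rearr2 (maxfn \<Phi> f))"
    by (simp_all add: fun_eq_iff rhoK1_def rhoK2_def cone_gauge_def cone_fibre_def
        INF_MEnorm_eq_INF_Enorm[OF assms])
qed

definition monotone_homogeneous :: "'a::euclidean_space function_norm \<Rightarrow> 'a cone_operator \<Rightarrow> bool" where
  "monotone_homogeneous \<rho> T \<longleftrightarrow>
     (\<forall>f\<in>Espace \<rho>. \<forall>g\<in>Espace \<rho>. (AE x in lebesgue. \<bar>f x\<bar> \<le> \<bar>g x\<bar>) \<longrightarrow> (\<forall>t>0. T f t \<le> T g t)) \<and>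
     (\<forall>f\<in>Espace \<rho>. \<forall>a\<ge>0. \<forall>t>0. T (\<lambda>x. a * f x) t = ennreal a * T f t)"

lemma monotone_homogeneousD:
  assumes "monotone_homogeneous \<rho> T" "f \<in> Espace \<rho>" "0 < t"
  shows "g \<in> Espace \<rho> \<Longrightarrow> AE x in lebesgue. \<bar>f x\<bar> \<le> \<bar>g x\<bar> \<Longrightarrow> T f t \<le> T g t"
    and "0 \<le> a \<Longrightarrow> T (\<lambda>x. a * f x) t = ennreal a * T f t"
  using assms unfolding monotone_homogeneous_def by blast+

definition dominated :: "'a::euclidean_space function_norm \<Rightarrow> 'a cone_operator
    \<Rightarrow> 'a cone_operator \<Rightarrow> bool" where
  "dominated \<rho> T S \<longleftrightarrow>
     (\<exists>C>0. \<forall>f\<in>Espace \<rho>. \<exists>g\<in>Espace \<rho>. Enorm \<rho> g \<le> Enorm \<rho> f \<and> (\<forall>t>0. T f t \<le> ennreal C * S g t))"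

lemma dominatedI:
  assumes "0 < C"
    and "\<And>f. f \<in> Espace \<rho> \<Longrightarrow> \<exists>g\<in>Espace \<rho>. Enorm \<rho> g \<le> Enorm \<rho> f \<and> (\<forall>t>0. T f t \<le> ennreal C * S g t)"
  shows "dominated \<rho> T S"
  using assms unfolding dominated_def by blast

lemma dominated_trans:
  assumes "dominated \<rho> T S" "dominated \<rho> S U"
  shows "dominated \<rho> T U"
proof -
  obtain C where C_pos: "0 < C"
    and C_dominates: "\<And>f. f \<in> Espace \<rho> \<Longrightarrow>
      \<exists>g\<in>Espace \<rho>. Enorm \<rho> g \<le> Enorm \<rho> f \<and> (\<forall>t>0. T f t \<le> ennreal C * S g t)"
    using assms(1) unfolding dominated_def by blast
  obtain D where D_pos: "0 < D"
    and D_dominates: "\<And>f. f \<in> Espace \<rho> \<Longrightarrow>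
      \<exists>g\<in>Espace \<rho>. Enorm \<rho> g \<le> Enorm \<rho> f \<and> (\<forall>t>0. S f t \<le> ennreal D * U g t)"
    using assms(2) unfolding dominated_def by blast
  show ?thesis
  proof (rule dominatedI)
    show "0 < C * D" using C_pos D_pos by simp
    fix f assume "f \<in> Espace \<rho>"
    from C_dominates[OF this] obtain g where g_Espace: "g \<in> Espace \<rho>"
      and norm_g_le: "Enorm \<rho> g \<le> Enorm \<rho> f"
      and Tf_le_Sg: "\<And>t. 0 < t \<Longrightarrow> T f t \<le> ennreal C * S g t" by blast
    from D_dominates[OF g_Espace] obtain h where h_Espace: "h \<in> Espace \<rho>"
      and norm_h_le: "Enorm \<rho> h \<le> Enorm \<rho> g"
      and Sg_le_Uh: "\<And>t. 0 < t \<Longrightarrow> S g t \<le> ennreal D * U h t" by blast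
    have "T f t \<le> ennreal (C * D) * U h t" if "0 < t" for t
      using order_trans[OF Tf_le_Sg[OF that] mult_left_mono[OF Sg_le_Uh[OF that], of "ennreal C"]] C_pos
      by (simp add: ennreal_mult' mult.assoc)
    with norm_g_le h_Espace norm_h_le
    show "\<exists>h\<in>Espace \<rho>. Enorm \<rho> h \<le> Enorm \<rho> f \<and> (\<forall>t>0. T f t \<le> ennreal (C * D) * U h t)"
      by (auto intro: order_trans)
  qed
qed

definition infinite_nowhere_or_everywhere :: "'a::euclidean_space function_norm
    \<Rightarrow> 'a cone_operator \<Rightarrow> bool" where
  "infinite_nowhere_or_everywhere \<rho> T \<longleftrightarrow>
     (\<forall>f\<in>Espace \<rho>. (\<exists>t>0. T f t = \<infinity>) \<longrightarrow> (\<forall>t>0. T f t = \<infinity>))"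

lemma
  assumes "f \<in> Espace \<rho>"
  shows in_cone: "T f \<in> cone \<rho> T" and cone_gauge_le: "cone_gauge \<rho> T (T f) \<le> Enorm \<rho> f"
  using assms unfolding cone_def cone_gauge_def cone_fibre_def by (auto intro: INF_lower)

lemma cone_gauge_lessE:
  assumes "cone_gauge \<rho> T h < y"
  obtains f where "f \<in> Espace \<rho>" "\<And>t. 0 < t \<Longrightarrow> T f t = h t" "Enorm \<rho> f < y"
  using assms unfolding cone_gauge_def cone_fibre_def by (auto simp: INF_less_iff)

lemma cone_gauge_infinite:
  assumes bfn: "banach_function_norm \<rho>" and T_mono_hom: "monotone_homogeneous \<rho> T"
    and f_Espace: "f \<in> Espace \<rho>" and Tf_infinite: "\<And>t. 0 < t \<Longrightarrow> T f t = \<infinity>"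
  shows "(\<lambda>_. \<infinity>) \<in> cone \<rho> T" and "cone_gauge \<rho> T (\<lambda>_. \<infinity>) = 0"
proof -
  show "(\<lambda>_. \<infinity>) \<in> cone \<rho> T"
    using f_Espace Tf_infinite by (auto simp: cone_def cone_fibre_def)
  obtain b where norm_f: "Enorm \<rho> f = ennreal b" and b_nonneg: "0 \<le> b"
    using Espace_norm_finite[OF f_Espace] by (cases "Enorm \<rho> f") auto
  have "cone_gauge \<rho> T (\<lambda>_. \<infinity>) \<le> 0"
  proof (rule ennreal_le_epsilon)
    fix e :: real assume e_pos: "0 < e"
    define a where "a = e / (b + 1)"
    have a_pos: "0 < a" and ab_le_e: "a * b \<le> e" using e_pos b_nonneg by (auto simp: a_def field_simps)
    have "(\<lambda>x. a * f x) \<in> cone_fibre \<rho> T (\<lambda>_. \<infinity>)"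
      using a_pos Tf_infinite Espace_cmult[OF bfn f_Espace, of a]
        monotone_homogeneousD(2)[OF T_mono_hom f_Espace]
      by (auto simp: cone_fibre_def ennreal_mult_top)
    then have "cone_gauge \<rho> T (\<lambda>_. \<infinity>) \<le> Enorm \<rho> (\<lambda>x. a * f x)"
      unfolding cone_gauge_def by (rule INF_lower)
    also have "\<dots> = ennreal (a * b)"
      using a_pos norm_f b_nonneg by (simp add: Enorm_cmult[OF bfn f_Espace] ennreal_mult)
    finally show "cone_gauge \<rho> T (\<lambda>_. \<infinity>) \<le> 0 + ennreal e"
      using ab_le_e by (auto intro: order_trans ennreal_leI)
  qed
  then show "cone_gauge \<rho> T (\<lambda>_. \<infinity>) = 0" by simp
qed

lemma cone_gauge_eq_0_imp_small_multiple:
  assumes bfn: "banach_function_norm \<rho>" and T_mono_hom: "monotone_homogeneous \<rho> T"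
    and gauge_eq_0: "cone_gauge \<rho> T h = 0" and "0 < a" "0 < e"
  shows "\<exists>f\<in>Espace \<rho>. Enorm \<rho> f \<le> ennreal e \<and> (\<forall>t>0. T f t = ennreal a * h t)"
proof -
  have "cone_gauge \<rho> T h < ennreal (e / a)" using gauge_eq_0 assms(4,5) by simp
  then obtain f where f_Espace: "f \<in> Espace \<rho>" and Tf_eq_h: "\<And>t. 0 < t \<Longrightarrow> T f t = h t"
    and norm_f_less: "Enorm \<rho> f < ennreal (e / a)"
    by (rule cone_gauge_lessE) auto
  have "Enorm \<rho> (\<lambda>x. a * f x) \<le> ennreal a * ennreal (e / a)"
    using \<open>0 < a\<close> norm_f_less by (simp add: Enorm_cmult[OF bfn f_Espace] mult_left_mono)
  also have "\<dots> = ennreal e" using \<open>0 < a\<close> by (simp flip: ennreal_mult')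
  finally show ?thesis
    using \<open>0 < a\<close> Tf_eq_h Espace_cmult[OF bfn f_Espace, of a]
      monotone_homogeneousD(2)[OF T_mono_hom f_Espace, of _ a]
    by (intro bexI[of _ "\<lambda>x. a * f x"]) auto
qed

text \<open>The gauge of a nonzero \<open>h\<close> can vanish. If \<open>T f\<^sub>k = (k + 1) h\<close> and \<open>\<Sum>k. \<parallel>f\<^sub>k\<parallel> < \<infinity>\<close>, then
  \<open>f = \<Sum>k. \<bar>f\<^sub>k\<bar>\<close> lies in \<open>E\<close> and \<open>T f \<ge> (k + 1) h\<close> for all \<open>k\<close>.\<close>
lemma cone_gauge_eq_0_imp_infinite:
  fixes \<rho> :: "'a::euclidean_space function_norm"
  assumes bfn: "banach_function_norm \<rho>" and T_mono_hom: "monotone_homogeneous \<rho> T"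
    and gauge_eq_0: "cone_gauge \<rho> T h = 0" and t_pos: "0 < t" and h_t_nonzero: "h t \<noteq> 0"
  obtains f where "f \<in> Espace \<rho>" "T f t = \<infinity>"
proof -
  have "\<exists>f\<in>Espace \<rho>. Enorm \<rho> f \<le> ennreal ((1/2) ^ k)
      \<and> (\<forall>t>0. T f t = ennreal (real (Suc k)) * h t)" for k
    by (rule cone_gauge_eq_0_imp_small_multiple[OF bfn T_mono_hom gauge_eq_0]) auto
  then obtain fs where fs_Espace: "\<And>k. fs k \<in> Espace \<rho>"
    and norm_fs_le: "\<And>k. Enorm \<rho> (fs k) \<le> ennreal ((1/2) ^ k)"
    and T_fs: "\<And>k. T (fs k) t = ennreal (real (Suc k)) * h t"
    using t_pos by metis
  have "(\<Sum>k. Enorm \<rho> (fs k)) \<le> (\<Sum>k. ennreal ((1/2) ^ k))"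
    using norm_fs_le by (intro suminf_le) auto
  also have "\<dots> < \<infinity>"
    by (subst suminf_ennreal2) auto
  finally obtain f where f_Espace: "f \<in> Espace \<rho>"
    and fs_le_f: "\<And>k. AE x in lebesgue. \<bar>fs k x\<bar> \<le> \<bar>f x\<bar>"
    using Espace_dominating_sequence[of \<rho> fs, OF bfn fs_Espace] by blast
  have "of_nat k * h t \<le> T f t" for k
  proof -
    have "of_nat k * h t \<le> T (fs k) t"
      unfolding T_fs ennreal_of_nat_eq_real_of_nat by (intro mult_right_mono ennreal_leI) auto
    also have "\<dots> \<le> T f t"
      by (rule monotone_homogeneousD(1)[OF T_mono_hom fs_Espace t_pos f_Espace fs_le_f])
    finally show ?thesis .
  qed
  then have "(SUP k. of_nat k :: ennreal) * h t \<le> T f t"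
    unfolding SUP_mult_right_ennreal by (rule SUP_least)
  then have "T f t = \<infinity>"
    using h_t_nonzero by (simp add: ennreal_SUP_of_nat_eq_top ennreal_top_mult top_unique)
  with f_Espace show ?thesis by (rule that)
qed

lemma cone_gauge_attained_up_to_factor_2:
  assumes bfn: "banach_function_norm \<rho>" and T_mono_hom: "monotone_homogeneous \<rho> T"
    and h_cone: "h \<in> cone \<rho> T"
    and definite: "cone_gauge \<rho> T h = 0 \<Longrightarrow> \<forall>t>0. h t = 0"
  obtains f where "f \<in> Espace \<rho>" "\<And>t. 0 < t \<Longrightarrow> T f t = h t" "Enorm \<rho> f \<le> 2 * cone_gauge \<rho> T h"
proof -
  obtain f where f_fibre: "f \<in> cone_fibre \<rho> T h" using h_cone by (auto simp: cone_def)
  then have f_Espace: "f \<in> Espace \<rho>" by (simp add: cone_fibre_def)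
  show ?thesis
  proof (cases "cone_gauge \<rho> T h = 0")
    case True
    have "T (\<lambda>x. 0 * f x) t = h t" if "0 < t" for t
      using monotone_homogeneousD(2)[OF T_mono_hom f_Espace that, of 0] definite[OF True] that by simp
    then show ?thesis
      using Espace_cmult[OF bfn f_Espace, of 0] Enorm_cmult[OF bfn f_Espace, of 0]
      by (intro that[of "\<lambda>x. 0 * f x"]) auto
  next
    case False
    have "cone_gauge \<rho> T h \<le> Enorm \<rho> f" unfolding cone_gauge_def by (rule INF_lower[OF f_fibre])
    also have "\<dots> < \<infinity>" by (rule Espace_norm_finite[OF f_Espace])
    finally have "cone_gauge \<rho> T h < 2 * cone_gauge \<rho> T h"
      using False by (cases "cone_gauge \<rho> T h") (auto simp: numeral_mult_ennreal ennreal_less_iff)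
    then show ?thesis
      by (rule cone_gauge_lessE) (rule that, auto)
  qed
qed

lemma dominated_rescaledE:
  assumes bfn: "banach_function_norm \<rho>" and S_mono_hom: "monotone_homogeneous \<rho> S"
    and "dominated \<rho> T S"
  obtains C where "0 < C" "\<And>f. f \<in> Espace \<rho> \<Longrightarrow>
    \<exists>g\<in>Espace \<rho>. Enorm \<rho> g \<le> ennreal C * Enorm \<rho> f \<and> (\<forall>t>0. T f t \<le> S g t)"
proof -
  obtain C where C_pos: "0 < C" and C_dominates: "\<And>f. f \<in> Espace \<rho> \<Longrightarrow>
      \<exists>g\<in>Espace \<rho>. Enorm \<rho> g \<le> Enorm \<rho> f \<and> (\<forall>t>0. T f t \<le> ennreal C * S g t)"
    using \<open>dominated \<rho> T S\<close> unfolding dominated_def by blast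
  show ?thesis
  proof (rule that[OF C_pos])
    fix f assume "f \<in> Espace \<rho>"
    from C_dominates[OF this] obtain g where g_Espace: "g \<in> Espace \<rho>" and norm_g_le: "Enorm \<rho> g \<le> Enorm \<rho> f"
      and Tf_le: "\<And>t. 0 < t \<Longrightarrow> T f t \<le> ennreal C * S g t" by blast
    show "\<exists>g\<in>Espace \<rho>. Enorm \<rho> g \<le> ennreal C * Enorm \<rho> f \<and> (\<forall>t>0. T f t \<le> S g t)"
    proof (intro bexI conjI allI impI)
      show "(\<lambda>x. C * g x) \<in> Espace \<rho>"
        using C_pos by (intro Espace_cmult[OF bfn g_Espace]) simp
      show "Enorm \<rho> (\<lambda>x. C * g x) \<le> ennreal C * Enorm \<rho> f"
        using C_pos norm_g_le by (simp add: Enorm_cmult[OF bfn g_Espace] mult_left_mono)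
      show "T f t \<le> S (\<lambda>x. C * g x) t" if "0 < t" for t
        using C_pos Tf_le[OF that] by (simp add: monotone_homogeneousD(2)[OF S_mono_hom g_Espace that])
    qed
  qed
qed

lemma covered_by_cone:
  fixes \<rho> :: "'a::euclidean_space function_norm"
  assumes bfn: "banach_function_norm \<rho>"
    and T_mono_hom: "monotone_homogeneous \<rho> T" and S_mono_hom: "monotone_homogeneous \<rho> S"
    and "dominated \<rho> T S"
    and dichotomy: "infinite_nowhere_or_everywhere \<rho> T \<or> infinite_nowhere_or_everywhere \<rho> S"
  shows "covered_by (cone \<rho> T) (cone_gauge \<rho> T) (cone \<rho> S) (cone_gauge \<rho> S)"
proof -
  obtain C where C_pos: "0 < C" and C_dominates: "\<And>f. f \<in> Espace \<rho> \<Longrightarrow>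
      \<exists>g\<in>Espace \<rho>. Enorm \<rho> g \<le> ennreal C * Enorm \<rho> f \<and> (\<forall>t>0. T f t \<le> S g t)"
    using dominated_rescaledE[OF bfn S_mono_hom \<open>dominated \<rho> T S\<close>] by blast
  have "\<exists>k\<in>cone \<rho> S. cone_gauge \<rho> S k \<le> ennreal (2 * C) * cone_gauge \<rho> T h \<and> (\<forall>t>0. h t \<le> k t)"
    if h_cone: "h \<in> cone \<rho> T" for h
  proof (cases "cone_gauge \<rho> T h = 0 \<and> (\<exists>t>0. h t \<noteq> 0)")
    case True
    then obtain t f where "0 < t" and f_Espace: "f \<in> Espace \<rho>" and "T f t = \<infinity>"
      using cone_gauge_eq_0_imp_infinite[OF bfn T_mono_hom] by metis
    from C_dominates[OF f_Espace] obtain g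
      where g_Espace: "g \<in> Espace \<rho>" and Tf_le_Sg: "\<And>t. 0 < t \<Longrightarrow> T f t \<le> S g t" by blast
    have "S g s = \<infinity>" if "0 < s" for s
      using dichotomy f_Espace g_Espace Tf_le_Sg \<open>0 < t\<close> \<open>T f t = \<infinity>\<close> that
      unfolding infinite_nowhere_or_everywhere_def by (metis infinity_ennreal_def top_unique)
    from cone_gauge_infinite[OF bfn S_mono_hom g_Espace this] show ?thesis
      by (intro bexI[of _ "\<lambda>_. \<infinity>"]) auto
  next
    case False
    then obtain f where f_Espace: "f \<in> Espace \<rho>" and Tf_eq_h: "\<And>t. 0 < t \<Longrightarrow> T f t = h t"
      and norm_f_le: "Enorm \<rho> f \<le> 2 * cone_gauge \<rho> T h"
      using cone_gauge_attained_up_to_factor_2[OF bfn T_mono_hom h_cone] by blast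
    from C_dominates[OF f_Espace] obtain g where g_Espace: "g \<in> Espace \<rho>"
      and norm_g_le: "Enorm \<rho> g \<le> ennreal C * Enorm \<rho> f" and Tf_le_Sg: "\<And>t. 0 < t \<Longrightarrow> T f t \<le> S g t"
      by blast
    have "cone_gauge \<rho> S (S g) \<le> Enorm \<rho> g" by (rule cone_gauge_le[OF g_Espace])
    also have "\<dots> \<le> ennreal C * (2 * cone_gauge \<rho> T h)"
      using norm_g_le mult_left_mono[OF norm_f_le, of "ennreal C"] by (rule order_trans) simp
    also have "\<dots> = ennreal (2 * C) * cone_gauge \<rho> T h" using C_pos by (simp add: ennreal_mult' ac_simps)
    finally show ?thesis
      using in_cone[OF g_Espace, of S] Tf_eq_h Tf_le_Sg by (intro bexI[of _ "S g"]) auto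
  qed
  with C_pos show ?thesis
    unfolding covered_by_def by (intro exI[of _ "2 * C"]) auto
qed

lemma cone_equiv_cone:
  assumes "banach_function_norm \<rho>" "monotone_homogeneous \<rho> T" "monotone_homogeneous \<rho> S"
    and "dominated \<rho> T S" "dominated \<rho> S T" "infinite_nowhere_or_everywhere \<rho> S"
  shows "cone_equiv (cone \<rho> T) (cone_gauge \<rho> T) (cone \<rho> S) (cone_gauge \<rho> S)"
  unfolding cone_equiv_def using assms by (blast intro: covered_by_cone)

section \<open>The cones generated by the maximal function\<close>

lemma borel_measurable_maxfn_Espace:
  "f \<in> Espace \<rho> \<Longrightarrow> maxfn \<Phi> f \<in> borel_measurable lebesgue"
  by (intro borel_measurable_lebesgueI borel_measurable_maxfn Espace_measurable)

lemma monotone_homogeneous_rearr_maxfn: "monotone_homogeneous \<rho> (\<lambda>f. rearr (maxfn \<Phi> f))"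
  and monotone_homogeneous_rearr2_maxfn: "monotone_homogeneous \<rho> (\<lambda>f. rearr2 (maxfn \<Phi> f))"
  and monotone_homogeneous_K3fun: "monotone_homogeneous \<rho> (K3fun n \<Phi>)"
  unfolding monotone_homogeneous_def
  by (auto simp: maxfn_cmult rearr_cmult rearr2_cmult K3fun_cmult Espace_measurable
      borel_measurable_maxfn_Espace
      intro!: rearr_mono_AE rearr2_mono_AE K3fun_mono_AE AE_I2 maxfn_mono_AE)

lemma infinite_nowhere_or_everywhere_K3fun:
  assumes ri: "ri_norm \<rho>" and \<Phi>_class_B: "class_B n \<Phi>" and "0 < n"
  shows "infinite_nowhere_or_everywhere \<rho> (K3fun n \<Phi>)"
  unfolding infinite_nowhere_or_everywhere_def
proof (intro ballI impI allI)
  fix f s assume f_Espace: "f \<in> Espace \<rho>" and "\<exists>t>0. K3fun n \<Phi> f t = \<infinity>" and s_pos: "0 < (s::real)"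
  then obtain t where t_pos: "0 < t" and K3fun_t_infinite: "K3fun n \<Phi> f t = \<infinity>" by blast
  have "rearr_integral (\<lambda>x. ennreal \<bar>f x\<bar>) s < \<infinity>"
    using f_Espace by (intro rearr_integral_finite[OF ri]) (auto simp: Espace_def)
  then have "ennreal (\<Phi> (root n t)) * rearr_integral (\<lambda>x. ennreal \<bar>f x\<bar>) s < \<infinity>"
    by (simp add: ennreal_mult_less_top)
  with K3fun_le_max[OF \<Phi>_class_B \<open>0 < n\<close> t_pos, of s f] K3fun_t_infinite s_pos show "K3fun n \<Phi> f s = \<infinity>"
    by (simp add: top_unique max_def split: if_splits)
qed

lemma dominated_rearr_maxfn_rearr2_maxfn:
  "dominated \<rho> (\<lambda>f. rearr (maxfn \<Phi> f)) (\<lambda>f. rearr2 (maxfn \<Phi> f))"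
  using rearr_le_rearr2 by (intro dominatedI[of 1]) auto

lemma dominated_rearr2_maxfn_K3fun:
  fixes \<rho> :: "'a::euclidean_space function_norm"
  assumes \<Phi>_class_B: "class_B DIM('a) \<Phi>"
  shows "dominated \<rho> (\<lambda>f. rearr2 (maxfn \<Phi> f)) (K3fun DIM('a) \<Phi>)"
proof -
  obtain C where "0 < C" "\<And>(f::'a \<Rightarrow> real) t. f \<in> borel_measurable lebesgue \<Longrightarrow> 0 < t \<Longrightarrow>
      rearr2 (maxfn \<Phi> f) t \<le> ennreal C * K3fun DIM('a) \<Phi> f t"
    using rearr2_maxfn_le_K3fun[OF \<Phi>_class_B] by blast
  then show ?thesis
    by (intro dominatedI[of C]) (auto dest: Espace_measurable)
qed

lemma dominated_K3fun_rearr_maxfn: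
  fixes \<rho> :: "'a::euclidean_space function_norm"
  assumes ri: "ri_norm \<rho>" and \<Phi>_class_B: "class_B DIM('a) \<Phi>"
  shows "dominated \<rho> (K3fun DIM('a) \<Phi>) (\<lambda>f. rearr (maxfn \<Phi> f))"
proof -
  obtain c where c_pos: "0 < c" and c_bound: "\<And>(f :: 'a \<Rightarrow> real) h t.
      f \<in> borel_measurable lebesgue \<Longrightarrow> h \<in> borel_measurable lebesgue \<Longrightarrow>
      AE x in lebesgue. ennreal \<bar>h x\<bar> = radial_rearr (\<lambda>x. ennreal \<bar>f x\<bar>) x \<Longrightarrow> 0 \<le> t \<Longrightarrow>
      K3fun DIM('a) \<Phi> f t \<le> ennreal c * rearr (maxfn \<Phi> h) t"
    using K3fun_le_rearr_maxfn[OF \<Phi>_class_B] by blast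
  show ?thesis
  proof (rule dominatedI[OF c_pos])
    fix f assume f_Espace: "f \<in> Espace \<rho>"
    have abs_f_measurable: "(\<lambda>x. ennreal \<bar>f x\<bar>) \<in> borel_measurable lebesgue"
      using Espace_measurable[OF f_Espace] by measurable
    let ?r = "radial_rearr (\<lambda>x. ennreal \<bar>f x\<bar>)"
    have radial_measurable: "?r \<in> borel_measurable lebesgue" and radial_norm: "\<rho> ?r = Enorm \<rho> f"
      using borel_measurable_lebesgueI[OF borel_measurable_radial_rearr[OF abs_f_measurable]]
        ri_norm_radial_rearr[OF ri abs_f_measurable]
      by (auto simp: Enorm_def)
    then obtain h where "h \<in> Espace \<rho>" "AE x in lebesgue. ennreal \<bar>h x\<bar> = ?r x" "Enorm \<rho> h = \<rho> ?r"
      using Espace_representativeE[OF ri_norm_bfn[OF ri] radial_measurable]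
        Espace_norm_finite[OF f_Espace] by auto
    with radial_norm c_bound[of f h] show "\<exists>g\<in>Espace \<rho>. Enorm \<rho> g \<le> Enorm \<rho> f \<and>
        (\<forall>t>0. K3fun DIM('a) \<Phi> f t \<le> ennreal c * rearr (maxfn \<Phi> g) t)"
      using Espace_measurable[OF f_Espace] by (intro bexI[of _ h]) (auto simp: Espace_measurable)
  qed
qed

theorem theorem3p5:
  fixes \<rho> :: "((real ^ 'n::finite) \<Rightarrow> ennreal) \<Rightarrow> ennreal"
    and \<Phi> :: "real \<Rightarrow> real"
  assumes "ri_norm \<rho>"
    and "class_B CARD('n) \<Phi>"
  shows "cone_equiv (K1 \<rho> \<Phi>) (rhoK1 \<rho> \<Phi>) (K2 \<rho> \<Phi>) (rhoK2 \<rho> \<Phi>)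
       \<and> cone_equiv (K2 \<rho> \<Phi>) (rhoK2 \<rho> \<Phi>) (K3 CARD('n) \<rho> \<Phi>) (rhoK3 CARD('n) \<rho> \<Phi>)
       \<and> cone_equiv (K1 \<rho> \<Phi>) (rhoK1 \<rho> \<Phi>) (K3 CARD('n) \<rho> \<Phi>) (rhoK3 CARD('n) \<rho> \<Phi>)"
proof -
  note bfn = ri_norm_bfn[OF assms(1)]
  have \<Phi>_class_B: "class_B DIM(real^'n) \<Phi>" using assms(2) by simp
  note rearr_by_rearr2 = dominated_rearr_maxfn_rearr2_maxfn[of \<rho> \<Phi>]
  have rearr2_by_K3fun: "dominated \<rho> (\<lambda>f. rearr2 (maxfn \<Phi> f)) (K3fun CARD('n) \<Phi>)"
    using dominated_rearr2_maxfn_K3fun[OF \<Phi>_class_B, of \<rho>] by simp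
  have K3fun_by_rearr: "dominated \<rho> (K3fun CARD('n) \<Phi>) (\<lambda>f. rearr (maxfn \<Phi> f))"
    using dominated_K3fun_rearr_maxfn[OF assms(1) \<Phi>_class_B] by simp
  note K3fun_dichotomy = infinite_nowhere_or_everywhere_K3fun[OF assms zero_less_card_finite]
  have "cone_equiv (K1 \<rho> \<Phi>) (rhoK1 \<rho> \<Phi>) (K3 CARD('n) \<rho> \<Phi>) (rhoK3 CARD('n) \<rho> \<Phi>)"
    unfolding K1_eq_cone[OF bfn] rhoK1_eq_cone_gauge[OF bfn] K3_eq_cone rhoK3_eq_cone_gauge
    by (rule cone_equiv_cone[OF bfn monotone_homogeneous_rearr_maxfn monotone_homogeneous_K3fun
          dominated_trans[OF rearr_by_rearr2 rearr2_by_K3fun] K3fun_by_rearr K3fun_dichotomy])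
  moreover have "cone_equiv (K2 \<rho> \<Phi>) (rhoK2 \<rho> \<Phi>) (K3 CARD('n) \<rho> \<Phi>) (rhoK3 CARD('n) \<rho> \<Phi>)"
    unfolding K2_eq_cone[OF bfn] rhoK2_eq_cone_gauge[OF bfn] K3_eq_cone rhoK3_eq_cone_gauge
    by (rule cone_equiv_cone[OF bfn monotone_homogeneous_rearr2_maxfn monotone_homogeneous_K3fun
          rearr2_by_K3fun dominated_trans[OF K3fun_by_rearr rearr_by_rearr2] K3fun_dichotomy])
  ultimately show ?thesis
    by (blast intro: cone_equiv_trans cone_equiv_sym)
qed

end
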